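(* Let $n\ge1$ and let $\mathcal{C}_n$ be the $n$-qubit projective Clifford group. The centralizer of $s_1^2$ in $\mathcal{C}_n$ is $$\mathrm{Cent}_{\mathcal{C}_n}(s_1^2)=\begin{cases}\langle h_1s_1h_1s_1^3h_1,\ s_1\rangle,& n=1,\\ \langle h_1s_1h_1s_1^3h_1,\ h_2,\dots,h_n,\ s_1,s_2,\dots,s_n,\ \Lambda_1,\Lambda_2,\dots,\Lambda_{n-1}\rangle,& n\ge2.\end{cases}$$ If $n\ge2$, then the generator $s_1$ can be omitted from this generating set.
   Context: Let $\omega$ be a primitive 8th root of unity and $Z=\begin{bmatrix}1&0\\0&-1\end{bmatrix}$, $X=\begin{bmatrix}0&1\\1&0\end{bmatrix}$, $H=\frac1{\sqrt2}\begin{bmatrix}1&1\\1&-1\end{bmatrix}$, $S=\begin{bmatrix}1&0\\0&\omega^2\end{bmatrix}$, $CZ=\mathrm{diag}(1,1,1,-1)$. For $U\in\{Z,X,H,S\}$ put $U_i=I_2^{\otimes(i-1)}\otimes U\otimes I_2^{\otimes(n-i)}$, and put $CZ_{i\to i+1}=I_2^{\otimes(i-1)}\otimes CZ\otimes I_2^{\otimes(n-i-1)}$ for $1\le i\le n-1$. The $n$-qubit Pauli group $\mathrm{Pauli}_n$ is the group generated by all $X_i$, $Z_i$ and $\omega^2 I_2^{\otimes n}$. The $n$-qubit Clifford group $\mathrm{Cliff}_n$ is the normalizer of $\mathrm{Pauli}_n$ in the unitary group $U(2^n)$ with global phases restricted to powers of $\omega$; it is the finite group generated by $\omega I_2^{\otimes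 n}$, all $H_i$, all $S_i$ and all $CZ_{i\to i+1}$. The $n$-qubit projective Clifford group is $\mathcal{C}_n=\mathrm{Cliff}_n/\langle\omega I_2^{\otimes n}\rangle$ (equivalently the normalizer of $\mathrm{Pauli}_n$ in $U(2^n)$ modulo all scalars). Write $h_i,s_i,\Lambda_i$ for the classes of $H_i,S_i,CZ_{i\to i+1}$ in $\mathcal{C}_n$; they generate $\mathcal{C}_n$. Convention: products in $\mathcal{C}_n$ are written from left to right (circuit order), i.e. the opposite of matrix multiplication: $[U][V]=[VU]$. For $u\in\mathcal{C}_n$, $\mathrm{Cent}_{\mathcal{C}_n}(u)=\{g\in\mathcal{C}_n: ug=gu\}$. *)

theory Defs
  imports
    "HOL-Algebra.Generated_Groups"
    "HOL-Algebra.Group_Action"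
    "Jordan_Normal_Form.Schur_Decomposition"
begin

definition primitive_8th_root :: "complex \<Rightarrow> bool" where
  "primitive_8th_root w \<longleftrightarrow> w ^ 8 = 1 \<and> (\<forall>k::nat. 0 < k \<and> k < 8 \<longrightarrow> w ^ k \<noteq> 1)"

definition kron :: "complex mat \<Rightarrow> complex mat \<Rightarrow> complex mat" where
  "kron A B = mat (dim_row A * dim_row B) (dim_col A * dim_col B)
     (\<lambda>(i, j). A $$ (i div dim_row B, j div dim_col B) * B $$ (i mod dim_row B, j mod dim_col B))"

definition mat_Z :: "complex mat" where
  "mat_Z = mat_of_rows_list 2 [[1, 0], [0, -1]]"

definition mat_X :: "complex mat" where
  "mat_X = mat_of_rows_list 2 [[0, 1], [1, 0]]"

definition mat_H :: "complex mat" where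
  "mat_H = (1 / complex_of_real (sqrt 2)) \<cdot>\<^sub>m mat_of_rows_list 2 [[1, 1], [1, -1]]"

definition mat_S :: "complex \<Rightarrow> complex mat" where
  "mat_S w = mat_of_rows_list 2 [[1, 0], [0, w ^ 2]]"

definition mat_CZ :: "complex mat" where
  "mat_CZ = mat_of_rows_list 4 [[1, 0, 0, 0], [0, 1, 0, 0], [0, 0, 1, 0], [0, 0, 0, -1]]"

text \<open>The \<open>k\<close>-fold tensor power of the identity of size 2 is the identity of size \<open>2 ^ k\<close>.
  Qubits are numbered from 1, as in the usual notation: \<open>on_qubit\<close> is meant for
  \<open>1 \<le> i \<le> n\<close> and \<open>CZ_gate\<close> for \<open>1 \<le> i \<le> n - 1\<close>; outside these ranges the
  truncated subtractions make the sizes meaningless.\<close>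

definition on_qubit :: "nat \<Rightarrow> nat \<Rightarrow> complex mat \<Rightarrow> complex mat" where
  "on_qubit n i U = kron (kron (1\<^sub>m (2 ^ (i - 1))) U) (1\<^sub>m (2 ^ (n - i)))"

definition CZ_gate :: "nat \<Rightarrow> nat \<Rightarrow> complex mat" where
  "CZ_gate n i = kron (kron (1\<^sub>m (2 ^ (i - 1))) mat_CZ) (1\<^sub>m (2 ^ (n - i - 1)))"

definition unitary_group :: "nat \<Rightarrow> complex mat monoid" where
  "unitary_group d =
     \<lparr>carrier = {U \<in> carrier_mat d d. mat_adjoint U * U = 1\<^sub>m d \<and> U * mat_adjoint U = 1\<^sub>m d},
      monoid.mult = (*), one = 1\<^sub>m d\<rparr>"

definition pauli_group :: "complex \<Rightarrow> nat \<Rightarrow> complex mat set" where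
  "pauli_group w n = generate (unitary_group (2 ^ n))
     ((\<lambda>i. on_qubit n i mat_X) ` {1..n} \<union> (\<lambda>i. on_qubit n i mat_Z) ` {1..n}
      \<union> {w ^ 2 \<cdot>\<^sub>m 1\<^sub>m (2 ^ n)})"

text \<open>The normalizer of the Pauli group in \<open>U(2^n)\<close>, with arbitrary global phases. Since the
  projective group below is the quotient by all of these phases, it is the same group as the one
  obtained by first restricting the phases to powers of \<open>w\<close> and then dividing them out.\<close>

definition pauli_normalizer :: "complex \<Rightarrow> nat \<Rightarrow> complex mat monoid" where
  "pauli_normalizer w n =
     (unitary_group (2 ^ n))\<lparr>carrier := normalizer (unitary_group (2 ^ n)) (pauli_group w n)\<rparr>"

definition global_phases :: "nat \<Rightarrow> complex mat set" where
  "global_phases n = {c \<cdot>\<^sub>m 1\<^sub>m (2 ^ n) | c. cmod c = 1}"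

definition opposite_group :: "'a monoid \<Rightarrow> 'a monoid" where
  "opposite_group G = G\<lparr>monoid.mult := (\<lambda>x y. y \<otimes>\<^bsub>G\<^esub> x)\<rparr>"

text \<open>The opposite multiplication implements circuit order: the product of the classes of
  \<open>U\<close> and \<open>V\<close>, in this order, is the class of the matrix product \<open>V * U\<close>.\<close>

definition proj_clifford :: "complex \<Rightarrow> nat \<Rightarrow> complex mat set monoid" where
  "proj_clifford w n = opposite_group (pauli_normalizer w n Mod global_phases n)"

definition phase_class :: "complex \<Rightarrow> nat \<Rightarrow> complex mat \<Rightarrow> complex mat set" where
  "phase_class w n U = global_phases n #>\<^bsub>pauli_normalizer w n\<^esub> U"

definition cliff_h :: "complex \<Rightarrow> nat \<Rightarrow> nat \<Rightarrow> complex mat set" where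
  "cliff_h w n i = phase_class w n (on_qubit n i mat_H)"

definition cliff_s :: "complex \<Rightarrow> nat \<Rightarrow> nat \<Rightarrow> complex mat set" where
  "cliff_s w n i = phase_class w n (on_qubit n i (mat_S w))"

definition cliff_cz :: "complex \<Rightarrow> nat \<Rightarrow> nat \<Rightarrow> complex mat set" where
  "cliff_cz w n i = phase_class w n (CZ_gate n i)"

definition centralizer :: "('a, 'b) monoid_scheme \<Rightarrow> 'a \<Rightarrow> 'a set" where
  "centralizer G u = {g \<in> carrier G. u \<otimes>\<^bsub>G\<^esub> g = g \<otimes>\<^bsub>G\<^esub> u}"

text \<open>The element \<open>h\<^sub>1 s\<^sub>1 h\<^sub>1 s\<^sub>1\<^sup>3 h\<^sub>1\<close>.\<close>

definition cliff_hshsh :: "complex \<Rightarrow> nat \<Rightarrow> complex mat set" where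
  "cliff_hshsh w n =
     cliff_h w n 1 \<otimes>\<^bsub>proj_clifford w n\<^esub> cliff_s w n 1 \<otimes>\<^bsub>proj_clifford w n\<^esub> cliff_h w n 1
     \<otimes>\<^bsub>proj_clifford w n\<^esub> (cliff_s w n 1 [^]\<^bsub>proj_clifford w n\<^esub> (3::nat))
     \<otimes>\<^bsub>proj_clifford w n\<^esub> cliff_h w n 1"

end

theory Submission
  imports Defs
begin

text \<open>
  The square \<open>s\<^sub>1\<^sup>2\<close> is the class of \<open>Z\<^sub>1\<close>, and \<open>Z\<^sub>1\<close> is an involution, so the class of a Clifford
  unitary \<open>U\<close> commutes with \<open>s\<^sub>1\<^sup>2\<close> exactly when \<open>U Z\<^sub>1 U\<^sup>* = \<plusminus> Z\<^sub>1\<close>. The gate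
  \<open>h\<^sub>1 s\<^sub>1 h\<^sub>1 s\<^sub>1\<^sup>3 h\<^sub>1\<close> sends \<open>Z\<^sub>1\<close> to \<open>- Z\<^sub>1\<close>, so it remains to write every \<open>U\<close> that fixes
  \<open>Z\<^sub>1\<close> in terms of the remaining generators.

  By Schur's lemma a unitary is determined, up to a phase, by the images of all \<open>X\<^sub>j\<close> and \<open>Z\<^sub>j\<close> under
  conjugation. These are straightened one qubit at a time. Suppose \<open>U\<close> fixes \<open>X\<^sub>j\<close> and \<open>Z\<^sub>j\<close> for all
  \<open>j < k\<close>. Then the image of \<open>Z\<^sub>k\<close> commutes with these Paulis, hence lives on the qubits
  \<open>k, \<dots>, n\<close>, and gates on these qubits carry it to a multiple of \<open>Z\<^sub>k\<close>
  (\<open>cliff_from_transitive\<close>). Once \<open>Z\<^sub>k\<close> is fixed, the image of \<open>X\<^sub>k\<close> anticommutes with it, and it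
  can be carried back to \<open>X\<^sub>k\<close> without moving \<open>Z\<^sub>k\<close> by \<open>s\<^sub>k\<close>, \<open>\<Lambda>\<^sub>k\<close> and gates on later qubits
  (\<open>fix_X_given_Z\<close>); here \<open>h\<^sub>k\<close> does not occur. Signs are repaired by Paulis. The sweep ends with a
  unitary that commutes with every Pauli, that is, with a phase (\<open>normalizer_fixing_below\<close>). For
  \<open>k = 1\<close> only the second half of the step is necessary, as \<open>Z\<^sub>1\<close> is already fixed, and this gives
  the stated generators (\<open>stabilizer_of_Z1\<close>).

  If \<open>n \<ge> 2\<close>, then a product of \<open>\<Lambda>\<^sub>1\<close>, \<open>h\<^sub>2\<close> and \<open>s\<^sub>2\<close> acts on \<open>X\<^sub>1\<close> and \<open>Z\<^sub>1\<close> as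
  \<open>s\<^sub>1\<close> does. By the sweep the two differ by a Clifford operation on the qubits \<open>2, \<dots>, n\<close>, whose
  gates are among the generators; so \<open>s\<^sub>1\<close> is redundant (\<open>S1_redundant\<close>).

  All of this uses only the commutation relations between gates and Paulis. It is carried out in a
  group that satisfies these relations; the matrices enter at the end, where Kronecker products are
  used to verify the relations.
\<close>

section \<open>Conjugation and normalizers\<close>

context group
begin

definition conj_by :: "'a \<Rightarrow> 'a \<Rightarrow> 'a" where
  "conj_by g p = g \<otimes> p \<otimes> inv g"

lemma conj_by_closed [simp, intro]:
  "g \<in> carrier G \<Longrightarrow> p \<in> carrier G \<Longrightarrow> conj_by g p \<in> carrier G"
  by (simp add: conj_by_def)

lemma conj_by_mult:
  "g \<in> carrier G \<Longrightarrow> p \<in> carrier G \<Longrightarrow> q \<in> carrier G \<Longrightarrow>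
     conj_by g (p \<otimes> q) = conj_by g p \<otimes> conj_by g q"
  unfolding conj_by_def by (simp add: m_assoc inv_solve_left)

lemma conj_by_comp:
  "g \<in> carrier G \<Longrightarrow> h \<in> carrier G \<Longrightarrow> p \<in> carrier G \<Longrightarrow>
     conj_by (g \<otimes> h) p = conj_by g (conj_by h p)"
  unfolding conj_by_def by (simp add: m_assoc inv_mult_group)

lemma conj_by_one_left [simp]: "p \<in> carrier G \<Longrightarrow> conj_by \<one> p = p"
  by (simp add: conj_by_def)

lemma conj_by_one [simp]: "g \<in> carrier G \<Longrightarrow> conj_by g \<one> = \<one>"
  by (simp add: conj_by_def)

lemma conj_by_eq_iff:
  "g \<in> carrier G \<Longrightarrow> p \<in> carrier G \<Longrightarrow> q \<in> carrier G \<Longrightarrow>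
     conj_by g p = q \<longleftrightarrow> g \<otimes> p = q \<otimes> g"
  unfolding conj_by_def by (metis inv_solve_right m_closed)

lemma conj_by_inv:
  assumes "g \<in> carrier G" "p \<in> carrier G"
  shows "conj_by (inv g) (conj_by g p) = p" "conj_by g (conj_by (inv g) p) = p"
  using assms conj_by_comp[of "inv g" g p] conj_by_comp[of g "inv g" p] by simp_all

lemma conj_by_inv_eq:
  assumes "g \<in> carrier G" "p \<in> carrier G" "conj_by g p = q"
  shows "conj_by (inv g) q = p"
  using conj_by_inv(1)[OF assms(1,2)] assms(3) by simp

lemma conj_by_generate_fixed:
  assumes "g \<in> generate G A" "A \<subseteq> carrier G" "p \<in> carrier G"
    and "\<And>a. a \<in> A \<Longrightarrow> conj_by a p = p"
  shows "conj_by g p = p"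
  using assms(1)
proof induction
  case one
  then show ?case using assms by simp
next
  case (incl h)
  then show ?case using assms by simp
next
  case (inv h)
  then show ?case using assms conj_by_inv_eq by blast
next
  case (eng h1 h2)
  then show ?case using assms generate_in_carrier by (simp add: conj_by_comp)
qed

lemma conj_by_generate_closed:
  assumes g: "g \<in> carrier G" and A: "A \<subseteq> carrier G"
    and gen: "\<And>a. a \<in> A \<Longrightarrow> conj_by g a \<in> generate G A" and p: "p \<in> generate G A"
  shows "conj_by g p \<in> generate G A"
  using p
proof induction
  case one
  then show ?case using g by (simp add: generate.one)
next
  case (incl h)
  then show ?case using gen by simp
next
  case (inv h)
  have "conj_by g (inv h) = inv (conj_by g h)"
    using g A inv unfolding conj_by_def by (simp add: inv_mult_group m_assoc subset_iff)
  then show ?case using gen[OF inv] A generate_m_inv_closed by simp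
next
  case (eng h1 h2)
  then show ?case using g A generate_in_carrier by (simp add: conj_by_mult generate.eng)
qed

lemma normalizer_iff_conj_by:
  assumes "P \<subseteq> carrier G"
  shows "g \<in> normalizer G P \<longleftrightarrow> g \<in> carrier G \<and> conj_by g ` P = P"
proof -
  have "g <# P #> inv g = conj_by g ` P"
    unfolding conj_by_def l_coset_def r_coset_def by auto
  then show ?thesis
    using assms unfolding normalizer_def stabilizer_def by auto
qed

text \<open>The hypothesis on \<open>inv g\<close> is what makes conjugation by \<open>g\<close> surjective on the subgroup: an
  infinite subgroup could be mapped properly into itself.\<close>
lemma normalizer_generateI:
  assumes g: "g \<in> carrier G" and A: "A \<subseteq> carrier G"
    and gen: "\<And>a. a \<in> A \<Longrightarrow> conj_by g a \<in> generate G A"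
    and gen': "\<And>a. a \<in> A \<Longrightarrow> conj_by (inv g) a \<in> generate G A"
  shows "g \<in> normalizer G (generate G A)"
proof -
  have "p \<in> conj_by g ` generate G A" if "p \<in> generate G A" for p
    using conj_by_generate_closed[OF _ A gen' that] conj_by_inv(2)[OF g, of p] g A
      generate_in_carrier[OF A that] by (metis image_eqI inv_closed)
  then have "conj_by g ` generate G A = generate G A"
    using conj_by_generate_closed[OF g A gen] by blast
  then show ?thesis
    using g normalizer_iff_conj_by[OF generate_incl[OF A]] by blast
qed

lemma generate_subsetI:
  assumes "A \<subseteq> generate G B" "B \<subseteq> carrier G"
  shows "generate G A \<subseteq> generate G B"
  using assms generate_subgroup_incl generate_is_subgroup by blast

end

section \<open>Groups with Pauli elements and Clifford gates\<close>

text \<open>The relations that the proof needs: \<open>\<Phi>\<close> plays the role of the global phases, \<open>m\<close> that of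
  \<open>-1\<close>, \<open>\<iota>\<close> that of \<open>\<omega>\<^sup>2\<close>, and \<open>C j\<close> that of the controlled-Z gate on the qubits \<open>j\<close> and
  \<open>j + 1\<close>. The multiplication is that of matrices. The assumption \<open>irreducible\<close> is Schur's lemma for
  the Pauli group, and \<open>square_roots\<close> is what turns an unknown phase into a sign.\<close>
locale clifford_gates = group G for G (structure) +
  fixes n :: nat and \<Phi> :: "'a set" and m \<iota> :: 'a and X Z H S C :: "nat \<Rightarrow> 'a"
  assumes phases: "subgroup \<Phi> G"
    and phase_central: "c \<in> \<Phi> \<Longrightarrow> g \<in> carrier G \<Longrightarrow> c \<otimes> g = g \<otimes> c"
    and iota: "\<iota> \<in> \<Phi>" "\<iota> \<otimes> \<iota> = m" and m: "m \<noteq> \<one>" "m \<otimes> m = \<one>"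
    and square_roots: "c \<in> \<Phi> \<Longrightarrow> c \<otimes> c = \<one> \<Longrightarrow> c = \<one> \<or> c = m"
    and carr: "j \<in> {1..n} \<Longrightarrow> X j \<in> carrier G" "j \<in> {1..n} \<Longrightarrow> Z j \<in> carrier G"
      "j \<in> {1..n} \<Longrightarrow> H j \<in> carrier G" "j \<in> {1..n} \<Longrightarrow> S j \<in> carrier G"
      "j \<in> {1..<n} \<Longrightarrow> C j \<in> carrier G"
    and irreducible: "U \<in> carrier G \<Longrightarrow>
      (\<And>j. j \<in> {1..n} \<Longrightarrow> U \<otimes> X j = X j \<otimes> U \<and> U \<otimes> Z j = Z j \<otimes> U) \<Longrightarrow> U \<in> \<Phi>"
    and XX: "j \<in> {1..n} \<Longrightarrow> X j \<otimes> X j = \<one>" and ZZ: "j \<in> {1..n} \<Longrightarrow> Z j \<otimes> Z j = \<one>"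
    and ZX: "j \<in> {1..n} \<Longrightarrow> Z j \<otimes> X j = m \<otimes> (X j \<otimes> Z j)"
    and X_X: "i \<in> {1..n} \<Longrightarrow> j \<in> {1..n} \<Longrightarrow> X i \<otimes> X j = X j \<otimes> X i"
    and Z_Z: "i \<in> {1..n} \<Longrightarrow> j \<in> {1..n} \<Longrightarrow> Z i \<otimes> Z j = Z j \<otimes> Z i"
    and X_Z: "i \<in> {1..n} \<Longrightarrow> j \<in> {1..n} \<Longrightarrow> i \<noteq> j \<Longrightarrow> X i \<otimes> Z j = Z j \<otimes> X i"
    and HX: "j \<in> {1..n} \<Longrightarrow> H j \<otimes> X j = Z j \<otimes> H j"
    and HZ: "j \<in> {1..n} \<Longrightarrow> H j \<otimes> Z j = X j \<otimes> H j"
    and H_X: "i \<in> {1..n} \<Longrightarrow> j \<in> {1..n} \<Longrightarrow> i \<noteq> j \<Longrightarrow> H j \<otimes> X i = X i \<otimes> H j"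
    and H_Z: "i \<in> {1..n} \<Longrightarrow> j \<in> {1..n} \<Longrightarrow> i \<noteq> j \<Longrightarrow> H j \<otimes> Z i = Z i \<otimes> H j"
    and SS: "j \<in> {1..n} \<Longrightarrow> S j \<otimes> S j = Z j"
    and SX: "j \<in> {1..n} \<Longrightarrow> S j \<otimes> X j = (\<iota> \<otimes> (X j \<otimes> Z j)) \<otimes> S j"
    and S_X: "i \<in> {1..n} \<Longrightarrow> j \<in> {1..n} \<Longrightarrow> i \<noteq> j \<Longrightarrow> S j \<otimes> X i = X i \<otimes> S j"
    and S_Z: "i \<in> {1..n} \<Longrightarrow> j \<in> {1..n} \<Longrightarrow> S j \<otimes> Z i = Z i \<otimes> S j"
    and CX: "j \<in> {1..<n} \<Longrightarrow> C j \<otimes> X j = (X j \<otimes> Z (Suc j)) \<otimes> C j"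
    and CX': "j \<in> {1..<n} \<Longrightarrow> C j \<otimes> X (Suc j) = (Z j \<otimes> X (Suc j)) \<otimes> C j"
    and C_X: "i \<in> {1..n} \<Longrightarrow> j \<in> {1..<n} \<Longrightarrow> i \<noteq> j \<Longrightarrow> i \<noteq> Suc j \<Longrightarrow> C j \<otimes> X i = X i \<otimes> C j"
    and C_Z: "i \<in> {1..n} \<Longrightarrow> j \<in> {1..<n} \<Longrightarrow> C j \<otimes> Z i = Z i \<otimes> C j"
begin

lemma phase_carr [simp]: "c \<in> \<Phi> \<Longrightarrow> c \<in> carrier G"
  using phases subgroup.mem_carrier by metis

lemma phase_mult [simp]: "c \<in> \<Phi> \<Longrightarrow> d \<in> \<Phi> \<Longrightarrow> c \<otimes> d \<in> \<Phi>"
  using phases subgroup.m_closed by metis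

lemma phase_inv [simp]: "c \<in> \<Phi> \<Longrightarrow> inv c \<in> \<Phi>"
  using phases subgroup.m_inv_closed by metis

lemma phase_one [simp]: "\<one> \<in> \<Phi>"
  using phases subgroup.one_closed by metis

lemma iota_phase [simp]: "\<iota> \<in> \<Phi>" and m_phase [simp]: "m \<in> \<Phi>"
  using iota phase_mult by auto

lemma conj_phase [simp]: "c \<in> \<Phi> \<Longrightarrow> g \<in> carrier G \<Longrightarrow> conj_by g c = c"
  by (metis conj_by_eq_iff phase_carr phase_central)

lemma conj_phase_mult:
  "c \<in> \<Phi> \<Longrightarrow> g \<in> carrier G \<Longrightarrow> p \<in> carrier G \<Longrightarrow> conj_by g (c \<otimes> p) = c \<otimes> conj_by g p"
  by (simp add: conj_by_mult)

lemma conj_by_phase: "c \<in> \<Phi> \<Longrightarrow> p \<in> carrier G \<Longrightarrow> conj_by c p = p"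
  by (metis conj_by_eq_iff phase_carr phase_central)

lemma phase_left_commute:
  "c \<in> \<Phi> \<Longrightarrow> g \<in> carrier G \<Longrightarrow> h \<in> carrier G \<Longrightarrow> g \<otimes> (c \<otimes> h) = c \<otimes> (g \<otimes> h)"
  by (metis m_assoc phase_carr phase_central)

lemma conj_H:
  assumes "j \<in> {1..n}"
  shows "conj_by (H j) (X j) = Z j" "conj_by (H j) (Z j) = X j"
  using assms carr HX HZ by (simp_all add: conj_by_eq_iff)

lemma conj_H_other:
  assumes "i \<in> {1..n}" "j \<in> {1..n}" "i \<noteq> j"
  shows "conj_by (H j) (X i) = X i" "conj_by (H j) (Z i) = Z i"
  using assms carr H_X H_Z by (simp_all add: conj_by_eq_iff)

lemma conj_S:
  assumes "j \<in> {1..n}"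
  shows "conj_by (S j) (X j) = \<iota> \<otimes> (X j \<otimes> Z j)"
  using assms carr SX by (simp add: conj_by_eq_iff)

lemma conj_S_X:
  assumes "i \<in> {1..n}" "j \<in> {1..n}" "i \<noteq> j"
  shows "conj_by (S j) (X i) = X i"
  using assms carr S_X by (simp add: conj_by_eq_iff)

lemma conj_S_Z:
  assumes "i \<in> {1..n}" "j \<in> {1..n}"
  shows "conj_by (S j) (Z i) = Z i"
  using assms carr S_Z by (simp add: conj_by_eq_iff)

lemma conj_C:
  assumes "j \<in> {1..<n}"
  shows "conj_by (C j) (X j) = X j \<otimes> Z (Suc j)"
    "conj_by (C j) (X (Suc j)) = Z j \<otimes> X (Suc j)"
  using assms carr CX CX' by (simp_all add: conj_by_eq_iff)

lemma conj_C_X: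
  assumes "i \<in> {1..n}" "j \<in> {1..<n}" "i \<noteq> j" "i \<noteq> Suc j"
  shows "conj_by (C j) (X i) = X i"
  using assms carr C_X by (simp add: conj_by_eq_iff)

lemma conj_C_Z:
  assumes "i \<in> {1..n}" "j \<in> {1..<n}"
  shows "conj_by (C j) (Z i) = Z i"
  using assms carr C_Z by (simp add: conj_by_eq_iff)

lemma conj_S_XZ:
  assumes "j \<in> {1..n}"
  shows "conj_by (S j) (X j \<otimes> Z j) = \<iota> \<otimes> X j"
proof -
  have "conj_by (S j) (X j \<otimes> Z j) = \<iota> \<otimes> (X j \<otimes> (Z j \<otimes> Z j))"
    using assms carr by (simp add: conj_by_mult conj_S conj_S_Z m_assoc)
  then show ?thesis using assms carr ZZ by simp
qed

lemma conj_C_XZ: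
  assumes "k \<in> {1..<n}"
  shows "conj_by (C k) (X k \<otimes> Z (Suc k)) = X k"
proof -
  have j: "k \<in> {1..n}" "Suc k \<in> {1..n}" using assms by auto
  show ?thesis
    using j assms carr ZZ[OF j(2)] by (simp add: conj_by_mult conj_C conj_C_Z m_assoc)
qed

lemma X_Z_not_central:
  assumes "j \<in> {1..n}"
  shows "X j \<notin> \<Phi>" "Z j \<notin> \<Phi>" "X j \<otimes> Z j \<noteq> Z j \<otimes> X j"
proof -
  show *: "X j \<otimes> Z j \<noteq> Z j \<otimes> X j"
    using ZX[OF assms] m carr assms
    by (metis l_one m_closed m_phase one_closed phase_carr right_cancel)
  show "X j \<notin> \<Phi>" "Z j \<notin> \<Phi>"
    using * phase_central carr assms by metis+
qed

section \<open>Pauli elements\<close>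

definition pauli :: "'a set" where
  "pauli = generate G (X ` {1..n} \<union> Z ` {1..n} \<union> {\<iota>})"

abbreviation norm_pauli :: "'a set" where
  "norm_pauli \<equiv> normalizer G pauli"

text \<open>The Paulis on the qubits from \<open>k\<close> onwards, with phases from all of \<open>\<Phi>\<close>: in the reduction phases
  are carried along as unknowns, so there is no point in keeping track of which of them occur.\<close>
definition paulis_from :: "nat \<Rightarrow> 'a set" where
  "paulis_from k = generate G (\<Phi> \<union> X ` {k..n} \<union> Z ` {k..n})"

lemma paulis_gens_carr: "1 \<le> k \<Longrightarrow> \<Phi> \<union> X ` {k..n} \<union> Z ` {k..n} \<subseteq> carrier G"
  using carr by auto

lemma pauli_gens_carr: "X ` {1..n} \<union> Z ` {1..n} \<union> {\<iota>} \<subseteq> carrier G"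
  using carr by auto

lemma paulis_from_carr: "1 \<le> k \<Longrightarrow> p \<in> paulis_from k \<Longrightarrow> p \<in> carrier G"
  unfolding paulis_from_def using generate_in_carrier paulis_gens_carr by blast

lemma pauli_carr: "pauli \<subseteq> carrier G"
  unfolding pauli_def using generate_incl[OF pauli_gens_carr] .

lemma pauli_subset: "pauli \<subseteq> paulis_from 1"
  unfolding pauli_def paulis_from_def by (intro mono_generate) auto

lemma paulis_from_top: "paulis_from (Suc n) = \<Phi>"
  unfolding paulis_from_def
  using generate_subgroup_incl[OF _ phases, of \<Phi>] by (auto intro: generate.incl)

lemma norm_pauli_subgroup: "subgroup norm_pauli G"
  using normalizer_imp_subgroup[OF pauli_carr] .

lemma norm_pauli_iff: "U \<in> norm_pauli \<longleftrightarrow> U \<in> carrier G \<and> conj_by U ` pauli = pauli"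
  using normalizer_iff_conj_by[OF pauli_carr] .

lemma norm_pauli_image:
  assumes "U \<in> norm_pauli" "j \<in> {1..n}"
  shows "conj_by U (X j) \<in> paulis_from 1" "conj_by U (Z j) \<in> paulis_from 1"
proof -
  have "X j \<in> pauli" "Z j \<in> pauli"
    unfolding pauli_def using assms(2) by (auto intro!: generate.incl)
  then show "conj_by U (X j) \<in> paulis_from 1" "conj_by U (Z j) \<in> paulis_from 1"
    using assms(1) pauli_subset unfolding norm_pauli_iff by blast+
qed

lemma phases_normalize: "\<Phi> \<subseteq> norm_pauli"
proof
  fix c assume "c \<in> \<Phi>"
  then have "conj_by c p = p" if "p \<in> pauli" for p
    using that pauli_carr conj_by_phase by blast
  then show "c \<in> norm_pauli"
    unfolding norm_pauli_iff using \<open>c \<in> \<Phi>\<close> by (auto simp: image_iff)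
qed


lemma in_pauli:
  "j \<in> {1..n} \<Longrightarrow> X j \<in> pauli" "j \<in> {1..n} \<Longrightarrow> Z j \<in> pauli" "\<iota> \<in> pauli" "inv \<iota> \<in> pauli"
  "p \<in> pauli \<Longrightarrow> q \<in> pauli \<Longrightarrow> p \<otimes> q \<in> pauli"
  unfolding pauli_def by (auto intro: generate.incl generate.inv generate.eng)

lemma normalizes_pauliI:
  assumes U: "U \<in> carrier G"
    and *: "\<And>j. j \<in> {1..n} \<Longrightarrow> conj_by U (X j) \<in> pauli \<and> conj_by U (Z j) \<in> pauli
         \<and> conj_by (inv U) (X j) \<in> pauli \<and> conj_by (inv U) (Z j) \<in> pauli"
  shows "U \<in> norm_pauli"
proof -
  have "conj_by U \<iota> \<in> pauli" "conj_by (inv U) \<iota> \<in> pauli"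
    using U in_pauli by simp_all
  then have "conj_by U a \<in> pauli \<and> conj_by (inv U) a \<in> pauli"
    if "a \<in> X ` {1..n} \<union> Z ` {1..n} \<union> {\<iota>}" for a
    using that * by blast
  then show ?thesis
    unfolding pauli_def by (intro normalizer_generateI[OF U pauli_gens_carr]) auto
qed

lemma H_normalizes:
  assumes j: "j \<in> {1..n}"
  shows "H j \<in> norm_pauli"
proof (rule normalizes_pauliI)
  show "H j \<in> carrier G" using j carr by simp
next
  fix i assume i: "i \<in> {1..n}"
  show "conj_by (H j) (X i) \<in> pauli \<and> conj_by (H j) (Z i) \<in> pauli \<and>
        conj_by (inv (H j)) (X i) \<in> pauli \<and> conj_by (inv (H j)) (Z i) \<in> pauli"
  proof (cases "i = j")
    case True
    then show ?thesis
      using j carr in_pauli conj_H conj_by_inv_eq by metis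
  next
    case False
    then show ?thesis
      using i j carr in_pauli conj_H_other conj_by_inv_eq by metis
  qed
qed

lemma S_normalizes:
  assumes j: "j \<in> {1..n}"
  shows "S j \<in> norm_pauli"
proof (rule normalizes_pauliI)
  show Sj: "S j \<in> carrier G" using j carr by simp
  fix i assume i: "i \<in> {1..n}"
  have Z: "conj_by (S j) (Z i) = Z i" "conj_by (inv (S j)) (Z i) = Z i"
    using conj_by_inv_eq conj_S_Z i j carr by metis+
  show "conj_by (S j) (X i) \<in> pauli \<and> conj_by (S j) (Z i) \<in> pauli \<and>
        conj_by (inv (S j)) (X i) \<in> pauli \<and> conj_by (inv (S j)) (Z i) \<in> pauli"
  proof (cases "i = j")
    case True
    have "conj_by (S j) (inv \<iota> \<otimes> (X j \<otimes> Z j)) = inv \<iota> \<otimes> (\<iota> \<otimes> X j)"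
      using conj_phase_mult[of "inv \<iota>" "S j" "X j \<otimes> Z j"] j carr conj_S_XZ by simp
    also have "\<dots> = X j"
      using j carr by (simp flip: m_assoc)
    finally have "conj_by (inv (S j)) (X j) = inv \<iota> \<otimes> (X j \<otimes> Z j)"
      using conj_by_inv_eq Sj j carr by (metis iota_phase m_closed phase_carr phase_inv)
    then show ?thesis
      using True Z j conj_S in_pauli by simp
  next
    case False
    then show ?thesis
      using i j carr in_pauli conj_S_X conj_by_inv_eq Z by metis
  qed
qed

lemma C_normalizes:
  assumes j: "j \<in> {1..<n}"
  shows "C j \<in> norm_pauli"
proof (rule normalizes_pauliI)
  have j': "j \<in> {1..n}" "Suc j \<in> {1..n}" using j by auto
  show Cj: "C j \<in> carrier G" using j carr by simp
  fix i assume i: "i \<in> {1..n}"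
  have Z: "conj_by (C j) (Z i) = Z i" "conj_by (inv (C j)) (Z i) = Z i"
    using conj_by_inv_eq conj_C_Z i j carr by metis+
  note XZ = conj_C_XZ[OF j]
  have ZX: "conj_by (C j) (Z j \<otimes> X (Suc j)) = X (Suc j)"
    using j' j carr Cj ZZ[OF j'(1)] by (simp add: conj_by_mult conj_C conj_C_Z flip: m_assoc)
  consider "i = j" | "i = Suc j" | "i \<noteq> j" "i \<noteq> Suc j" by blast
  then show "conj_by (C j) (X i) \<in> pauli \<and> conj_by (C j) (Z i) \<in> pauli \<and>
        conj_by (inv (C j)) (X i) \<in> pauli \<and> conj_by (inv (C j)) (Z i) \<in> pauli"
  proof cases
    case 1
    have "conj_by (inv (C j)) (X j) = X j \<otimes> Z (Suc j)"
      using conj_by_inv_eq[OF Cj _ XZ] j' carr by simp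
    then show ?thesis using 1 Z conj_C[OF j] j' in_pauli by simp
  next
    case 2
    have "conj_by (inv (C j)) (X (Suc j)) = Z j \<otimes> X (Suc j)"
      using conj_by_inv_eq[OF Cj _ ZX] j' carr by simp
    then show ?thesis using 2 Z conj_C[OF j] j' in_pauli by simp
  next
    case 3
    then show ?thesis
      using i j carr in_pauli conj_C_X conj_by_inv_eq Z by metis
  qed
qed

text \<open>The Paulis on qubit \<open>k\<close>, up to phases; \<open>X k \<otimes> Z k\<close> is Y up to a phase.\<close>
definition one_qubit :: "nat \<Rightarrow> 'a set" where
  "one_qubit k = {\<one>, X k, Z k, X k \<otimes> Z k}"

lemma one_qubit_carr: "k \<in> {1..n} \<Longrightarrow> \<sigma> \<in> one_qubit k \<Longrightarrow> \<sigma> \<in> carrier G"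
  unfolding one_qubit_def using carr by auto

lemma later_commutes:
  assumes k: "k \<in> {1..n}" and q: "q \<in> paulis_from (Suc k)"
  shows "X k \<otimes> q = q \<otimes> X k" "Z k \<otimes> q = q \<otimes> Z k"
proof -
  have qc: "q \<in> carrier G" using paulis_from_carr[OF _ q] by simp
  have *: "conj_by a p = p" if "a \<in> \<Phi> \<union> X ` {Suc k..n} \<union> Z ` {Suc k..n}" "p = X k \<or> p = Z k" for a p
  proof -
    have "a \<otimes> p = p \<otimes> a"
      using that k X_X Z_Z X_Z carr phase_central by fastforce
    then show ?thesis using that k carr by (auto simp: conj_by_eq_iff)
  qed
  have "conj_by q p = p" if p: "p = X k \<or> p = Z k" for p
    using conj_by_generate_fixed[OF _ paulis_gens_carr, of q "Suc k" p] * p q k carr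
    unfolding paulis_from_def by fastforce
  then have "conj_by q (X k) = X k" "conj_by q (Z k) = Z k" by blast+
  then show "X k \<otimes> q = q \<otimes> X k" "Z k \<otimes> q = q \<otimes> Z k"
    using qc k carr by (simp_all add: conj_by_eq_iff)
qed

lemma phase_in_paulis_from: "c \<in> \<Phi> \<Longrightarrow> c \<in> paulis_from k"
  unfolding paulis_from_def by (simp add: generate.incl)

lemma paulis_from_mult: "p \<in> paulis_from k \<Longrightarrow> q \<in> paulis_from k \<Longrightarrow> p \<otimes> q \<in> paulis_from k"
  unfolding paulis_from_def by (rule generate.eng)

text \<open>Left multiplication by any generator preserves the products \<open>\<sigma> \<otimes> q\<close>: the generators on later
  qubits pass the first factor, and on qubit \<open>k\<close> a product of Paulis is a Pauli up to a phase,
  which can be moved into the second factor.\<close>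
lemma paulis_from_factor:
  assumes k: "k \<in> {1..n}" and p: "p \<in> paulis_from k"
  shows "\<exists>\<sigma>\<in>one_qubit k. \<exists>q\<in>paulis_from (Suc k). p = \<sigma> \<otimes> q"
proof -
  define F where "F = {\<sigma> \<otimes> q | \<sigma> q. \<sigma> \<in> one_qubit k \<and> q \<in> paulis_from (Suc k)}"
  note Xk = carr(1)[OF k] and Zk = carr(2)[OF k]
  have qc: "q \<in> carrier G" if "q \<in> paulis_from (Suc k)" for q
    using paulis_from_carr[OF _ that] by simp
  have F_carr: "f \<in> carrier G" if "f \<in> F" for f
    using that qc one_qubit_carr[OF k] unfolding F_def by auto
  have mult_q: "g \<otimes> f \<in> F" if g: "g \<in> paulis_from (Suc k)" and "f \<in> F" for g f
  proof -
    obtain \<sigma> q where f: "f = \<sigma> \<otimes> q" "\<sigma> \<in> one_qubit k" "q \<in> paulis_from (Suc k)"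
      using \<open>f \<in> F\<close> unfolding F_def by blast
    have "g \<otimes> \<sigma> = \<sigma> \<otimes> g"
      using f(2) later_commutes[OF k g] qc[OF g] Xk Zk unfolding one_qubit_def
      by (auto simp: m_assoc) (metis m_assoc)
    then have "g \<otimes> f = \<sigma> \<otimes> (g \<otimes> q)"
      using f qc[OF g] qc[OF f(3)] one_qubit_carr[OF k f(2)] by (metis m_assoc)
    then show ?thesis
      using f g paulis_from_mult unfolding F_def by blast
  qed
  have mult_\<sigma>: "g \<otimes> f \<in> F" if g: "g = X k \<or> g = Z k" and "f \<in> F" for g f
  proof -
    obtain \<sigma> q where f: "f = \<sigma> \<otimes> q" "\<sigma> \<in> one_qubit k" "q \<in> paulis_from (Suc k)"
      using \<open>f \<in> F\<close> unfolding F_def by blast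
    have "X k \<otimes> (X k \<otimes> Z k) = Z k"
      using XX[OF k] Xk Zk by (simp flip: m_assoc)
    moreover have "Z k \<otimes> (X k \<otimes> Z k) = m \<otimes> X k"
      using ZZ[OF k] ZX[OF k] Xk Zk by (metis m_assoc m_closed m_phase phase_carr r_one)
    ultimately have "g \<otimes> \<sigma> \<in> one_qubit k \<or> (\<exists>\<tau>\<in>one_qubit k. g \<otimes> \<sigma> = m \<otimes> \<tau>)"
      using f(2) g Xk Zk ZX[OF k] XX[OF k] ZZ[OF k] unfolding one_qubit_def by auto
    then obtain \<tau> c where \<tau>: "g \<otimes> \<sigma> = c \<otimes> \<tau>" "\<tau> \<in> one_qubit k" "c \<in> \<Phi>"
      by (metis l_one m_phase one_qubit_carr[OF k] phase_one)
    have "g \<otimes> f = (c \<otimes> \<tau>) \<otimes> q"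
      using f(1) \<tau>(1) g Xk Zk qc[OF f(3)] one_qubit_carr[OF k f(2)] by (metis m_assoc)
    also have "\<dots> = \<tau> \<otimes> (c \<otimes> q)"
      using qc[OF f(3)] one_qubit_carr[OF k \<tau>(2)] \<tau>(3)
      by (metis m_assoc phase_carr phase_central)
    finally show ?thesis
      using \<tau> f(3) paulis_from_mult[OF phase_in_paulis_from] unfolding F_def by blast
  qed
  have inv_eq: "inv (X j) = X j" "inv (Z j) = Z j" if "j \<in> {1..n}" for j
    using XX[OF that] ZZ[OF that] carr that by (simp_all add: inv_equality)
  have gens: "g \<otimes> f \<in> F \<and> inv g \<otimes> f \<in> F"
    if g: "g \<in> \<Phi> \<union> X ` {k..n} \<union> Z ` {k..n}" and f: "f \<in> F" for g f
  proof (cases "g = X k \<or> g = Z k")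
    case True
    then show ?thesis using mult_\<sigma>[OF _ f] inv_eq k by fastforce
  next
    case False
    then have "g \<in> \<Phi> \<union> X ` {Suc k..n} \<union> Z ` {Suc k..n}"
      using g by (auto simp: Suc_le_eq) (metis imageI atLeastAtMost_iff Suc_leI order_neq_le_trans)+
    then have "g \<in> paulis_from (Suc k)" "inv g \<in> paulis_from (Suc k)"
      unfolding paulis_from_def by (auto intro: generate.incl generate.inv)
    then show ?thesis using mult_q f by blast
  qed
  have "\<forall>f\<in>F. p \<otimes> f \<in> F"
    using p unfolding paulis_from_def
  proof induction
    case (eng h1 h2)
    then have "h1 \<in> carrier G" "h2 \<in> carrier G"
      using generate_in_carrier[OF paulis_gens_carr] k by auto
    then show ?case using eng F_carr by (simp add: m_assoc)
  qed (use gens F_carr in auto)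
  moreover have "\<one> \<otimes> \<one> \<in> F"
    using phase_in_paulis_from[OF phase_one, of "Suc k"] unfolding F_def one_qubit_def by blast
  ultimately have "p \<in> F"
    using p k paulis_from_carr[of k p] by (metis atLeastAtMost_iff one_closed r_one)
  then show ?thesis unfolding F_def by blast
qed

text \<open>Each of \<open>X k\<close>, \<open>Z k\<close> and \<open>X k \<otimes> Z k\<close> anticommutes with \<open>X k\<close> or with \<open>Z k\<close>, so the part on qubit
  \<open>k\<close> must be trivial.\<close>
lemma paulis_from_commute:
  assumes k: "k \<in> {1..n}" and p: "p \<in> paulis_from k"
    and "X k \<otimes> p = p \<otimes> X k" "Z k \<otimes> p = p \<otimes> Z k"
  shows "p \<in> paulis_from (Suc k)"
proof -
  note Xk = carr(1)[OF k] and Zk = carr(2)[OF k]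
  obtain \<sigma> q where f: "p = \<sigma> \<otimes> q" "\<sigma> \<in> one_qubit k" "q \<in> paulis_from (Suc k)"
    using paulis_from_factor[OF k p] by blast
  have qc: "q \<in> carrier G" using paulis_from_carr[OF _ f(3)] by simp
  have sc: "\<sigma> \<in> carrier G" using one_qubit_carr[OF k f(2)] .
  have comm: "a \<otimes> \<sigma> = \<sigma> \<otimes> a"
    if "a \<in> carrier G" "a \<otimes> p = p \<otimes> a" "a \<otimes> q = q \<otimes> a" for a
  proof -
    have "(a \<otimes> \<sigma>) \<otimes> q = (\<sigma> \<otimes> a) \<otimes> q"
      using that f(1) qc sc by (metis m_assoc)
    then show ?thesis using that qc sc by (metis m_closed right_cancel)
  qed
  have s: "X k \<otimes> \<sigma> = \<sigma> \<otimes> X k" "Z k \<otimes> \<sigma> = \<sigma> \<otimes> Z k"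
    using comm assms later_commutes[OF k f(3)] Xk Zk by auto
  have "\<sigma> \<noteq> X k" "\<sigma> \<noteq> Z k"
    using s X_Z_not_central(3)[OF k] by auto
  moreover have "\<sigma> \<noteq> X k \<otimes> Z k"
  proof
    assume "\<sigma> = X k \<otimes> Z k"
    then have "X k \<otimes> (X k \<otimes> Z k) = X k \<otimes> (Z k \<otimes> X k)"
      using s(1) Xk Zk by (simp add: m_assoc)
    then show False using X_Z_not_central(3)[OF k] Xk Zk by simp
  qed
  ultimately have "\<sigma> = \<one>" using f(2) unfolding one_qubit_def by blast
  then show ?thesis using f qc by simp
qed

end

context clifford_gates
begin

section \<open>Reduction of a normalizing element, one qubit at a time\<close>
definition gates_from :: "nat \<Rightarrow> 'a set" where
  "gates_from k = H ` {k..n} \<union> S ` {k..n} \<union> C ` {k..<n}"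

definition cliff_from :: "nat \<Rightarrow> 'a set" where
  "cliff_from k = generate G (\<Phi> \<union> gates_from k)"

text \<open>Compared with \<open>cliff_from k\<close> only the generator \<open>H k\<close> is missing, the one that moves \<open>Z k\<close>.\<close>
definition cliff_fixing_Z :: "nat \<Rightarrow> 'a set" where
  "cliff_fixing_Z k = generate G (\<Phi> \<union> ({S k} \<union> C ` {k..<n} \<union> gates_from (Suc k)))"

lemma gates_from_normalize: "1 \<le> k \<Longrightarrow> gates_from k \<subseteq> norm_pauli"
  unfolding gates_from_def using H_normalizes S_normalizes C_normalizes by auto

lemma norm_pauli_carr: "norm_pauli \<subseteq> carrier G"
  using norm_pauli_subgroup subgroup.subset by blast

lemma norm_pauli_mult: "g \<in> norm_pauli \<Longrightarrow> h \<in> norm_pauli \<Longrightarrow> g \<otimes> h \<in> norm_pauli"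
  using norm_pauli_subgroup subgroup.m_closed by metis

lemma cliff_from_gens: "1 \<le> k \<Longrightarrow> \<Phi> \<union> gates_from k \<subseteq> norm_pauli"
  using phases_normalize gates_from_normalize by simp

lemma cliff_fixing_Z_gens:
  "k \<in> {1..n} \<Longrightarrow> \<Phi> \<union> ({S k} \<union> C ` {k..<n} \<union> gates_from (Suc k)) \<subseteq> norm_pauli"
  using phases_normalize gates_from_normalize[of "Suc k"] S_normalizes C_normalizes by auto

lemma cliff_from_normalizes: "1 \<le> k \<Longrightarrow> cliff_from k \<subseteq> norm_pauli"
  unfolding cliff_from_def using generate_subgroup_incl[OF cliff_from_gens norm_pauli_subgroup] .

lemma cliff_fixing_Z_normalizes: "k \<in> {1..n} \<Longrightarrow> cliff_fixing_Z k \<subseteq> norm_pauli"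
  unfolding cliff_fixing_Z_def
  using generate_subgroup_incl[OF cliff_fixing_Z_gens norm_pauli_subgroup] .

lemma cliff_from_mult: "g \<in> cliff_from k \<Longrightarrow> h \<in> cliff_from k \<Longrightarrow> g \<otimes> h \<in> cliff_from k"
  unfolding cliff_from_def by (rule generate.eng)

lemma cliff_fixing_Z_mult:
  "g \<in> cliff_fixing_Z k \<Longrightarrow> h \<in> cliff_fixing_Z k \<Longrightarrow> g \<otimes> h \<in> cliff_fixing_Z k"
  unfolding cliff_fixing_Z_def by (rule generate.eng)

lemma cliff_from_carr: "1 \<le> k \<Longrightarrow> g \<in> cliff_from k \<Longrightarrow> g \<in> carrier G"
  using cliff_from_normalizes norm_pauli_carr by blast

lemma cliff_fixing_Z_carr: "k \<in> {1..n} \<Longrightarrow> g \<in> cliff_fixing_Z k \<Longrightarrow> g \<in> carrier G"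
  using cliff_fixing_Z_normalizes norm_pauli_carr by blast

lemma cliff_from_inv: "1 \<le> k \<Longrightarrow> g \<in> cliff_from k \<Longrightarrow> inv g \<in> cliff_from k"
  unfolding cliff_from_def using generate_m_inv_closed cliff_from_gens norm_pauli_carr by blast

lemma cliff_fixing_Z_inv: "k \<in> {1..n} \<Longrightarrow> g \<in> cliff_fixing_Z k \<Longrightarrow> inv g \<in> cliff_fixing_Z k"
  unfolding cliff_fixing_Z_def
  using generate_m_inv_closed cliff_fixing_Z_gens norm_pauli_carr by blast

lemma in_cliff_from:
  "c \<in> \<Phi> \<Longrightarrow> c \<in> cliff_from k"
  "j \<in> {k..n} \<Longrightarrow> H j \<in> cliff_from k" "j \<in> {k..n} \<Longrightarrow> S j \<in> cliff_from k"
  "j \<in> {k..<n} \<Longrightarrow> C j \<in> cliff_from k"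
  unfolding cliff_from_def gates_from_def by (auto intro: generate.incl)

lemma cliff_from_mono: "k \<le> l \<Longrightarrow> cliff_from l \<subseteq> cliff_from k"
  unfolding cliff_from_def gates_from_def by (intro mono_generate) auto

lemma cliff_from_Suc_subset: "cliff_from (Suc k) \<subseteq> cliff_fixing_Z k"
  unfolding cliff_from_def cliff_fixing_Z_def by (intro mono_generate) auto

lemma cliff_fixing_Z_subset: "k \<in> {1..n} \<Longrightarrow> cliff_fixing_Z k \<subseteq> cliff_from k"
  unfolding cliff_from_def cliff_fixing_Z_def gates_from_def by (intro mono_generate) auto

lemma in_cliff_fixing_Z:
  "S k \<in> cliff_fixing_Z k" "j \<in> {k..<n} \<Longrightarrow> C j \<in> cliff_fixing_Z k"
  unfolding cliff_fixing_Z_def by (auto intro: generate.incl)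

lemma cliff_from_fixes_earlier:
  assumes g: "g \<in> cliff_from k" and j: "j \<in> {1..<k}" and k: "k \<le> Suc n"
  shows "conj_by g (X j) = X j" "conj_by g (Z j) = Z j"
proof -
  have jn: "j \<in> {1..n}" using j k by auto
  have carr': "\<Phi> \<union> gates_from k \<subseteq> carrier G"
    using cliff_from_gens[of k] norm_pauli_carr j by fastforce
  have "conj_by a (X j) = X j \<and> conj_by a (Z j) = Z j" if "a \<in> \<Phi> \<union> gates_from k" for a
    using that j k jn carr unfolding gates_from_def
    by (auto simp: conj_by_phase conj_H_other conj_S_X conj_S_Z conj_C_X conj_C_Z)
  then show "conj_by g (X j) = X j" "conj_by g (Z j) = Z j"
    using conj_by_generate_fixed[OF _ carr', of g] g jn carr unfolding cliff_from_def by auto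
qed

lemma cliff_fixing_Z_fixes:
  assumes g: "g \<in> cliff_fixing_Z k" and k: "k \<in> {1..n}"
  shows "conj_by g (Z k) = Z k"
proof -
  have carr': "\<Phi> \<union> ({S k} \<union> C ` {k..<n} \<union> gates_from (Suc k)) \<subseteq> carrier G"
    using cliff_fixing_Z_gens[OF k] norm_pauli_carr by blast
  have "conj_by a (Z k) = Z k" if "a \<in> \<Phi> \<union> ({S k} \<union> C ` {k..<n} \<union> gates_from (Suc k))" for a
    using that k carr unfolding gates_from_def
    by (auto simp: conj_by_phase conj_H_other conj_S_Z conj_C_Z)
  then show ?thesis
    using conj_by_generate_fixed[OF _ carr', of g] g k carr unfolding cliff_fixing_Z_def by auto
qed

lemma one_qubit_to_X:
  assumes k: "k \<in> {1..n}" and s: "\<sigma> \<in> one_qubit k" "\<sigma> \<noteq> \<one>"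
  shows "\<exists>g\<in>generate G {H k, S k}. \<exists>c\<in>\<Phi>. conj_by g \<sigma> = c \<otimes> X k"
proof -
  have "conj_by \<one> (X k) = \<one> \<otimes> X k" "conj_by (H k) (Z k) = \<one> \<otimes> X k"
    "conj_by (S k) (X k \<otimes> Z k) = \<iota> \<otimes> X k"
    using k carr conj_H conj_S_XZ by simp_all
  moreover have "\<one> \<in> generate G {H k, S k}" "H k \<in> generate G {H k, S k}" "S k \<in> generate G {H k, S k}"
    by (auto intro: generate.one generate.incl)
  ultimately show ?thesis
    using s unfolding one_qubit_def by (metis emptyE insertE iota_phase phase_one)
qed

lemma one_qubit_gates_fix_other:
  assumes "g \<in> generate G {H k, S k}" "k \<in> {1..n}" "j \<in> {1..n}" "j \<noteq> k"
  shows "conj_by g (Z j) = Z j"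
proof (rule conj_by_generate_fixed[OF assms(1)])
  fix a assume "a \<in> {H k, S k}"
  then show "conj_by a (Z j) = Z j" using assms conj_H_other conj_S_Z by auto
qed (use assms carr in auto)

lemma one_qubit_gates_subset: "k \<le> n \<Longrightarrow> generate G {H k, S k} \<subseteq> cliff_from k"
  unfolding cliff_from_def gates_from_def by (intro mono_generate) auto

lemma conj_phase_eq_comp:
  assumes "g \<in> carrier G" "h \<in> carrier G" "p \<in> carrier G" "q \<in> carrier G"
    and "c \<in> \<Phi>" "d \<in> \<Phi>" "r \<in> carrier G" "conj_by g p = c \<otimes> q" "conj_by h q = d \<otimes> r"
  shows "conj_by (h \<otimes> g) p = (c \<otimes> d) \<otimes> r"
  using assms by (simp add: conj_by_comp conj_phase_mult m_assoc)

text \<open>Write \<open>p = \<sigma> \<otimes> q\<close> with \<open>\<sigma>\<close> on qubit \<open>k\<close> and \<open>q\<close> on the later ones. If \<open>q\<close> is not a phase, then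
  recursively \<open>q\<close> becomes \<open>Z (k + 1)\<close>, and \<open>C k\<close> absorbs it, since it exchanges \<open>X k \<otimes> Z (k + 1)\<close>
  and \<open>X k\<close>. It therefore suffices to bring \<open>\<sigma>\<close> to \<open>X k\<close>, which \<open>H k\<close> and \<open>S k\<close> do unless \<open>\<sigma>\<close> is
  trivial.\<close>
lemma cliff_from_transitive:
  assumes "k \<in> {1..n}" "p \<in> paulis_from k" "p \<notin> \<Phi>"
  shows "\<exists>g\<in>cliff_from k. \<exists>c\<in>\<Phi>. conj_by g p = c \<otimes> Z k"
  using assms
proof (induction "n - k" arbitrary: k p rule: less_induct)
  case less
  note k = less.prems(1)
  have k1: "1 \<le> k" and kn: "k \<in> {k..n}" using k by auto
  note Xk = carr(1)[OF k] and Zk = carr(2)[OF k] and Hk = carr(3)[OF k]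
  have pc: "p \<in> carrier G" using paulis_from_carr less.prems k by auto
  obtain \<sigma> q where f: "p = \<sigma> \<otimes> q" "\<sigma> \<in> one_qubit k" "q \<in> paulis_from (Suc k)"
    using paulis_from_factor[OF k less.prems(2)] by blast
  have qc: "q \<in> carrier G" using paulis_from_carr[OF _ f(3)] by simp
  have sc: "\<sigma> \<in> carrier G" using one_qubit_carr[OF k f(2)] .
  have to_X: ?case if g: "g \<in> cliff_from k" and c: "c \<in> \<Phi>" and eq: "conj_by g p = c \<otimes> X k" for g c
  proof -
    have "conj_by (H k \<otimes> g) p = c \<otimes> Z k"
      using conj_phase_eq_comp[OF _ Hk pc Xk c phase_one Zk eq] cliff_from_carr[OF k1 g] conj_H[OF k]
        c Zk by simp
    then show ?case using c g cliff_from_mult in_cliff_from(2)[OF kn] by blast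
  qed
  show ?case
  proof (cases "q \<in> \<Phi>")
    case True
    have "\<sigma> \<noteq> \<one>" using f True less.prems(3) by auto
    then obtain g c where g: "g \<in> generate G {H k, S k}" "c \<in> \<Phi>" "conj_by g \<sigma> = c \<otimes> X k"
      using one_qubit_to_X[OF k f(2)] by blast
    have gk: "g \<in> cliff_from k" using g(1) one_qubit_gates_subset k by auto
    have "conj_by g p = (c \<otimes> X k) \<otimes> q"
      using f(1) g(3) True cliff_from_carr[OF k1 gk] sc by (simp add: conj_by_mult)
    also have "\<dots> = (q \<otimes> c) \<otimes> X k"
      using True g(2) Xk by (metis m_assoc m_closed phase_carr phase_central)
    finally show ?thesis using to_X[OF gk phase_mult[OF True g(2)]] by blast
  next
    case False
    have "k \<noteq> n" using False f(3) paulis_from_top by auto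
    then have kk: "k \<in> {1..<n}" "Suc k \<in> {1..n}" "n - Suc k < n - k" using k by auto
    note X' = carr(1)[OF kk(2)] and Z' = carr(2)[OF kk(2)] and H' = carr(3)[OF kk(2)]
      and Ck = carr(5)[OF kk(1)]
    obtain g c where g: "g \<in> cliff_from (Suc k)" "c \<in> \<Phi>" "conj_by g q = c \<otimes> Z (Suc k)"
      using less.hyps[OF kk(3,2) f(3) False] by blast
    have gc: "g \<in> carrier G" using cliff_from_carr[OF _ g(1)] by simp
    have gk: "g \<in> cliff_from k" using g(1) cliff_from_mono[of k "Suc k"] by auto
    have mem: "C k \<in> cliff_from k" "H k \<in> cliff_from k" "H (Suc k) \<in> cliff_from k"
      using kk in_cliff_from by auto
    show ?thesis
    proof (cases "\<sigma> = \<one>")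
      case True
      \<comment> \<open>From right to left the gates send \<open>Z (k + 1)\<close> to \<open>X (k + 1)\<close>, \<open>Z k \<otimes> X (k + 1)\<close>,
          \<open>Z k \<otimes> Z (k + 1)\<close>, \<open>X k \<otimes> Z (k + 1)\<close> and \<open>X k\<close>.\<close>
      define h where "h = C k \<otimes> (H k \<otimes> (H (Suc k) \<otimes> (C k \<otimes> H (Suc k))))"
      have h: "h \<in> carrier G" unfolding h_def using Ck Hk H' by simp
      have "conj_by h (Z (Suc k)) = X k"
        unfolding h_def using Ck Hk H' Xk X' Zk Z' kk k
        by (simp add: conj_by_comp conj_by_mult conj_H conj_H_other conj_C conj_C_Z[OF kk(2,1)]
            ZZ[OF kk(2)] m_assoc)
      then have "conj_by (h \<otimes> g) p = c \<otimes> X k"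
        using conj_phase_eq_comp[OF gc h qc Z' g(2) phase_one Xk g(3)] True f(1) qc g(2) Xk by simp
      moreover have "h \<otimes> g \<in> cliff_from k"
        unfolding h_def using mem gk cliff_from_mult by simp
      ultimately show ?thesis using to_X g(2) by blast
    next
      case False
      obtain a d where a: "a \<in> generate G {H k, S k}" "d \<in> \<Phi>" "conj_by a \<sigma> = d \<otimes> X k"
        using one_qubit_to_X[OF k f(2) False] by blast
      have ak: "a \<in> cliff_from k" using a(1) one_qubit_gates_subset k by auto
      have ac: "a \<in> carrier G" using cliff_from_carr[OF k1 ak] .
      have "conj_by g (X k) = X k" "conj_by g (Z k) = Z k"
        using cliff_from_fixes_earlier[OF g(1), of k] k by auto
      then have "conj_by g \<sigma> = \<sigma>"
        using f(2) gc Xk Zk unfolding one_qubit_def by (auto simp: conj_by_mult)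
      then have "conj_by g p = c \<otimes> (\<sigma> \<otimes> Z (Suc k))"
        using f(1) g gc sc qc phase_left_commute[OF g(2) sc Z'] by (simp add: conj_by_mult)
      moreover have "conj_by a (\<sigma> \<otimes> Z (Suc k)) = d \<otimes> (X k \<otimes> Z (Suc k))"
        using a ac sc Z' Xk one_qubit_gates_fix_other[OF a(1) k kk(2)]
        by (simp add: conj_by_mult m_assoc)
      ultimately have "conj_by (a \<otimes> g) p = (c \<otimes> d) \<otimes> (X k \<otimes> Z (Suc k))"
        using conj_phase_eq_comp[OF gc ac pc _ g(2) a(2),
            where q = "\<sigma> \<otimes> Z (Suc k)" and r = "X k \<otimes> Z (Suc k)"] sc Z' Xk by simp
      then have "conj_by (C k \<otimes> (a \<otimes> g)) p = (c \<otimes> d) \<otimes> X k"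
        using conj_C_XZ[OF kk(1)] ac gc pc g(2) a(2) Ck Xk Z'
          conj_by_comp[OF Ck, of "a \<otimes> g" p] by (simp add: conj_phase_mult)
      moreover have "C k \<otimes> (a \<otimes> g) \<in> cliff_from k"
        using mem ak gk cliff_from_mult by simp
      ultimately show ?thesis using to_X phase_mult[OF g(2) a(2)] by blast
    qed
  qed
qed

lemma sign_of_conj:
  assumes U: "U \<in> carrier G" and p: "p \<in> carrier G" "p \<otimes> p = \<one>"
    and c: "c \<in> \<Phi>" "conj_by U p = c \<otimes> q" and q: "q \<in> carrier G" "q \<otimes> q = \<one>"
  shows "c = \<one> \<or> c = m"
proof -
  have "\<one> = conj_by U p \<otimes> conj_by U p"
    using U p conj_by_mult[OF U p(1) p(1)] by simp
  also have "\<dots> = (c \<otimes> c) \<otimes> (q \<otimes> q)"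
    unfolding c(2) using c(1) q(1) by (metis m_assoc m_closed phase_carr phase_central)
  also have "\<dots> = c \<otimes> c"
    unfolding q(2) using c(1) by simp
  finally show ?thesis using square_roots[OF c(1)] by metis
qed

lemma conj_by_X_Z:
  assumes k: "k \<in> {1..n}"
  shows "conj_by (Z k) (X k) = m \<otimes> X k" "conj_by (X k) (Z k) = m \<otimes> Z k"
    "conj_by (Z k) (Z k) = Z k"
proof -
  note Xk = carr(1)[OF k] and Zk = carr(2)[OF k]
  show "conj_by (Z k) (X k) = m \<otimes> X k" "conj_by (Z k) (Z k) = Z k"
    using Xk Zk ZX[OF k] by (simp_all add: conj_by_eq_iff m_assoc)
  have "X k \<otimes> Z k = m \<otimes> (Z k \<otimes> X k)"
    using Xk Zk ZX[OF k] m by (simp flip: m_assoc)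
  then show "conj_by (X k) (Z k) = m \<otimes> Z k"
    using Xk Zk by (simp add: conj_by_eq_iff m_assoc)
qed


lemma Z_in_cliff_fixing_Z: "k \<in> {1..n} \<Longrightarrow> Z k \<in> cliff_fixing_Z k"
  using in_cliff_fixing_Z(1) cliff_fixing_Z_mult SS by metis

text \<open>The element \<open>H k \<otimes> (Z k \<otimes> H k)\<close> replaces \<open>X k\<close>: it acts in the same way and lies visibly in the
  group generated by the gates.\<close>
lemma conj_by_HZH:
  assumes k: "k \<in> {1..n}"
  shows "conj_by (H k \<otimes> (Z k \<otimes> H k)) (Z k) = m \<otimes> Z k"
  using k carr by (simp add: conj_by_comp conj_H conj_by_X_Z conj_phase_mult)

definition fixes_below :: "'a \<Rightarrow> nat \<Rightarrow> bool" where
  "fixes_below U k \<longleftrightarrow> (\<forall>j\<in>{1..<k}. conj_by U (X j) = X j \<and> conj_by U (Z j) = Z j)"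

lemma fixes_below_comp:
  assumes "fixes_below g k" "fixes_below h k" "g \<in> carrier G" "h \<in> carrier G" "k \<le> Suc n"
  shows "fixes_below (g \<otimes> h) k"
  using assms carr unfolding fixes_below_def by (auto simp: conj_by_comp)

lemma cliff_from_fixes_below:
  "g \<in> cliff_from k \<Longrightarrow> k \<le> Suc n \<Longrightarrow> fixes_below g k"
  unfolding fixes_below_def using cliff_from_fixes_earlier by blast

text \<open>Conjugation preserves commutation, so the image of \<open>X k\<close> or \<open>Z k\<close> commutes with the fixed
  elements \<open>X j\<close> and \<open>Z j\<close>; these cut off the qubits \<open>j < k\<close> one after the other.\<close>
lemma paulis_from_if_fixes_below:
  assumes U: "U \<in> norm_pauli" "fixes_below U k" and k: "k \<in> {1..n}"
    and p: "p = X k \<or> p = Z k"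
  shows "conj_by U p \<in> paulis_from k"
proof -
  have Uc: "U \<in> carrier G" using U norm_pauli_carr by blast
  have "conj_by U p \<in> paulis_from j" if "1 \<le> j" "j \<le> k" for j
    using that
  proof (induction j rule: dec_induct)
    case base
    then show ?case using norm_pauli_image[OF U(1) k] p by auto
  next
    case (step j)
    have j: "j \<in> {1..n}" "j < k" using step k by auto
    have fixj: "conj_by U (X j) = X j" "conj_by U (Z j) = Z j"
      using U(2) j unfolding fixes_below_def by auto
    have pc: "p \<in> carrier G" using p k carr by auto
    have "X j \<otimes> p = p \<otimes> X j" "Z j \<otimes> p = p \<otimes> Z j"
      using p j k X_X X_Z Z_Z by auto
    then have "X j \<otimes> conj_by U p = conj_by U p \<otimes> X j" "Z j \<otimes> conj_by U p = conj_by U p \<otimes> Z j"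
      using fixj Uc pc carr j conj_by_mult by metis+
    then show ?case
      using paulis_from_commute[OF j(1)] step by simp
  qed
  then show ?thesis using k by simp
qed

text \<open>The image of \<open>X k\<close> anticommutes with \<open>Z k\<close>, so its part on qubit \<open>k\<close> is \<open>X k\<close> or
  \<open>X k \<otimes> Z k\<close>, and \<open>S k\<close> turns the second into the first. What it carries on later qubits is made
  \<open>Z (k + 1)\<close> by gates on these and removed by \<open>C k\<close>. None of this moves \<open>Z k\<close>. The remaining
  phase is a sign, and \<open>Z k\<close> corrects it.\<close>
lemma fix_X_given_Z:
  assumes U: "U \<in> norm_pauli" "fixes_below U k" and k: "k \<in> {1..n}" and UZ: "conj_by U (Z k) = Z k"
  shows "\<exists>g\<in>cliff_fixing_Z k. fixes_below (g \<otimes> U) (Suc k)"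
proof -
  note Xk = carr(1)[OF k] and Zk = carr(2)[OF k] and Sk = carr(4)[OF k]
  have Uc: "U \<in> carrier G" using U norm_pauli_carr by blast
  have mem: "S k \<in> cliff_fixing_Z k" using in_cliff_fixing_Z by blast
  define p where "p = conj_by U (X k)"
  have pc: "p \<in> carrier G" unfolding p_def using Uc Xk by simp
  have "p \<in> paulis_from k"
    unfolding p_def using paulis_from_if_fixes_below[OF U k] by blast
  then obtain \<sigma> q where f: "p = \<sigma> \<otimes> q" "\<sigma> \<in> one_qubit k" "q \<in> paulis_from (Suc k)"
    using paulis_from_factor[OF k] by blast
  have qc: "q \<in> carrier G" using paulis_from_carr[OF _ f(3)] by simp
  have sc: "\<sigma> \<in> carrier G" using one_qubit_carr[OF k f(2)] .
  have Zp: "Z k \<otimes> p = m \<otimes> (p \<otimes> Z k)"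
    using conj_by_mult[OF Uc Zk Xk] conj_by_mult[OF Uc Xk Zk] ZX[OF k] Uc Xk Zk UZ
    unfolding p_def by (metis conj_phase_mult m_closed m_phase)
  have "\<sigma> = X k \<or> \<sigma> = X k \<otimes> Z k"
  proof (rule ccontr)
    assume "\<not> ?thesis"
    then have "Z k \<otimes> \<sigma> = \<sigma> \<otimes> Z k"
      using f(2) Zk unfolding one_qubit_def by auto
    then have "Z k \<otimes> p = p \<otimes> Z k"
      using f(1) later_commutes(2)[OF k f(3)] Zk qc sc by (metis m_assoc)
    then have "m \<otimes> (p \<otimes> Z k) = \<one> \<otimes> (p \<otimes> Z k)"
      using Zp pc Zk by simp
    then show False using m pc Zk right_cancel[of "p \<otimes> Z k" m \<one>] by simp
  qed
  then obtain a d where a: "a \<in> cliff_fixing_Z k" "d \<in> \<Phi>" "conj_by a \<sigma> = d \<otimes> X k"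
      "\<And>j. j \<in> {1..n} \<Longrightarrow> conj_by a (Z j) = Z j"
  proof (elim disjE)
    assume "\<sigma> = X k"
    then show thesis
      using that[of \<one> \<one>] Xk carr(2) unfolding cliff_fixing_Z_def by (simp add: generate.one)
  next
    assume "\<sigma> = X k \<otimes> Z k"
    then show thesis
      using that[of "S k" \<iota>] mem conj_S_XZ[OF k] conj_S_Z[OF _ k] by auto
  qed
  have ac: "a \<in> carrier G" using cliff_fixing_Z_carr[OF k a(1)] .
  have "\<exists>g\<in>cliff_fixing_Z k. \<exists>c\<in>\<Phi>. conj_by g p = c \<otimes> X k"
  proof (cases "q \<in> \<Phi>")
    case True
    have "conj_by a p = (d \<otimes> X k) \<otimes> q"
      using f(1) a(3) True ac sc by (simp add: conj_by_mult)
    also have "\<dots> = (q \<otimes> d) \<otimes> X k"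
      using True a(2) Xk by (metis m_assoc m_closed phase_carr phase_central)
    finally show ?thesis using a phase_mult[OF True a(2)] by blast
  next
    case False
    have "k \<noteq> n" using False f(3) paulis_from_top by auto
    then have kk: "k \<in> {1..<n}" "Suc k \<in> {1..n}" using k by auto
    note Z' = carr(2)[OF kk(2)] and Ck = carr(5)[OF kk(1)]
    obtain g c where g: "g \<in> cliff_from (Suc k)" "c \<in> \<Phi>" "conj_by g q = c \<otimes> Z (Suc k)"
      using cliff_from_transitive[OF kk(2) f(3) False] by blast
    have gc: "g \<in> carrier G" using cliff_from_carr[OF _ g(1)] by simp
    have "conj_by g (X k) = X k" "conj_by g (Z k) = Z k"
      using cliff_from_fixes_earlier[OF g(1), of k] k by auto
    then have "conj_by g \<sigma> = \<sigma>"
      using f(2) gc Xk Zk unfolding one_qubit_def by (auto simp: conj_by_mult)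
    then have "conj_by g p = c \<otimes> (\<sigma> \<otimes> Z (Suc k))"
      using f(1) g gc sc qc phase_left_commute[OF g(2) sc Z'] by (simp add: conj_by_mult)
    moreover have "conj_by a (\<sigma> \<otimes> Z (Suc k)) = d \<otimes> (X k \<otimes> Z (Suc k))"
      using a ac sc Z' Xk kk(2) by (simp add: conj_by_mult m_assoc)
    ultimately have "conj_by (a \<otimes> g) p = (c \<otimes> d) \<otimes> (X k \<otimes> Z (Suc k))"
      using conj_phase_eq_comp[OF gc ac pc _ g(2) a(2),
            where q = "\<sigma> \<otimes> Z (Suc k)" and r = "X k \<otimes> Z (Suc k)"] sc Z' Xk by simp
    then have "conj_by (C k \<otimes> (a \<otimes> g)) p = (c \<otimes> d) \<otimes> X k"
      using conj_C_XZ[OF kk(1)] ac gc pc g(2) a(2) Ck Xk Z'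
        conj_by_comp[OF Ck, of "a \<otimes> g" p] by (simp add: conj_phase_mult)
    moreover have "C k \<otimes> (a \<otimes> g) \<in> cliff_fixing_Z k"
      using a(1) subsetD[OF cliff_from_Suc_subset g(1)] in_cliff_fixing_Z(2)[of k k] kk(1)
      by (simp add: cliff_fixing_Z_mult)
    ultimately show ?thesis using phase_mult[OF g(2) a(2)] by blast
  qed
  then obtain g c where g: "g \<in> cliff_fixing_Z k" "c \<in> \<Phi>" "conj_by g p = c \<otimes> X k"
    by blast
  have gc: "g \<in> carrier G" using cliff_fixing_Z_carr[OF k g(1)] .
  have gU: "conj_by (g \<otimes> U) (X k) = c \<otimes> X k"
    using g(3) gc Uc Xk unfolding p_def by (simp add: conj_by_comp)
  have "\<exists>h\<in>cliff_fixing_Z k. conj_by (h \<otimes> U) (X k) = X k"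
    using sign_of_conj[OF _ Xk XX[OF k] g(2) gU Xk XX[OF k]]
  proof
    show "g \<otimes> U \<in> carrier G" using gc Uc by simp
    assume "c = \<one>"
    then show ?thesis using g gU Xk by auto
  next
    assume c: "c = m"
    have "conj_by (Z k \<otimes> g \<otimes> U) (X k) = conj_by (Z k) (m \<otimes> X k)"
      using gU c gc Uc Zk Xk conj_by_comp[of "Z k" "g \<otimes> U" "X k"] by (simp add: m_assoc)
    also have "\<dots> = X k"
      using conj_by_X_Z[OF k] Xk Zk m by (simp add: conj_phase_mult flip: m_assoc)
    finally show ?thesis
      using cliff_fixing_Z_mult[OF Z_in_cliff_fixing_Z[OF k] g(1)] by blast
  qed
  then obtain h where h: "h \<in> cliff_fixing_Z k" "conj_by (h \<otimes> U) (X k) = X k"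
    by blast
  have hc: "h \<in> carrier G" using cliff_fixing_Z_carr[OF k h(1)] .
  have "fixes_below h k"
    using cliff_from_fixes_below cliff_fixing_Z_subset[OF k] h(1) k by auto
  then have "fixes_below (h \<otimes> U) k"
    using fixes_below_comp U(2) hc Uc k by simp
  moreover have "conj_by (h \<otimes> U) (Z k) = Z k"
    using UZ hc Uc Zk cliff_fixing_Z_fixes[OF h(1) k] by (simp add: conj_by_comp)
  ultimately have "fixes_below (h \<otimes> U) (Suc k)"
    using h(2) unfolding fixes_below_def by (auto simp: less_Suc_eq)
  then show ?thesis using h(1) by blast
qed

lemma cliff_from_cancel:
  assumes "g \<in> cliff_from k" "g \<otimes> U \<in> cliff_from k" "U \<in> carrier G" "1 \<le> k"
  shows "U \<in> cliff_from k"
proof -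
  have "U = inv g \<otimes> (g \<otimes> U)"
    using assms cliff_from_carr[OF assms(4,1)] by (simp flip: m_assoc)
  then show ?thesis using cliff_from_mult cliff_from_inv assms by metis
qed

lemma cliff_fixing_Z_cancel:
  assumes "g \<in> cliff_fixing_Z k" "g \<otimes> U \<in> cliff_fixing_Z k" "U \<in> carrier G" "k \<in> {1..n}"
  shows "U \<in> cliff_fixing_Z k"
proof -
  have "U = inv g \<otimes> (g \<otimes> U)"
    using assms cliff_fixing_Z_carr[OF assms(4,1)] by (simp flip: m_assoc)
  then show ?thesis using cliff_fixing_Z_mult cliff_fixing_Z_inv assms by metis
qed

text \<open>The sweep. For \<open>k = 1\<close> it says that the phases and the gates generate the whole normalizer of
  the Pauli group.\<close>
lemma normalizer_fixing_below:
  assumes "1 \<le> k" "k \<le> Suc n" "U \<in> norm_pauli" "fixes_below U k"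
  shows "U \<in> cliff_from k"
  using assms
proof (induction "Suc n - k" arbitrary: k U rule: less_induct)
  case less
  have Uc: "U \<in> carrier G" using less.prems norm_pauli_carr by blast
  show ?case
  proof (cases "k = Suc n")
    case True
    then have "U \<otimes> X j = X j \<otimes> U \<and> U \<otimes> Z j = Z j \<otimes> U" if "j \<in> {1..n}" for j
      using less.prems(4) that Uc carr conj_by_eq_iff unfolding fixes_below_def by fastforce
    then have "U \<in> \<Phi>" using irreducible[OF Uc] by blast
    then show ?thesis using in_cliff_from by blast
  next
    case False
    then have k: "k \<in> {1..n}" and k1: "1 \<le> k" using less.prems by auto
    note Xk = carr(1)[OF k] and Zk = carr(2)[OF k] and Hk = carr(3)[OF k]
    have "conj_by U (Z k) \<notin> \<Phi>"
    proof
      assume "conj_by U (Z k) \<in> \<Phi>"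
      then have "Z k \<in> \<Phi>"
        using conj_by_inv(1)[OF Uc Zk] conj_phase[of "conj_by U (Z k)" "inv U"] Uc by simp
      then show False using X_Z_not_central[OF k] by blast
    qed
    then obtain g c where g: "g \<in> cliff_from k" "c \<in> \<Phi>" "conj_by g (conj_by U (Z k)) = c \<otimes> Z k"
      using cliff_from_transitive[OF k paulis_from_if_fixes_below[OF less.prems(3,4) k]] by blast
    have gc: "g \<in> carrier G" using cliff_from_carr[OF k1 g(1)] .
    have gU: "conj_by (g \<otimes> U) (Z k) = c \<otimes> Z k"
      using g(3) gc Uc Zk by (simp add: conj_by_comp)
    have "\<exists>h\<in>cliff_from k. conj_by (h \<otimes> U) (Z k) = Z k"
      using sign_of_conj[OF _ Zk ZZ[OF k] g(2) gU Zk ZZ[OF k]]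
    proof
      show "g \<otimes> U \<in> carrier G" using gc Uc by simp
      assume "c = \<one>"
      then show ?thesis using g gU Zk by auto
    next
      assume c: "c = m"
      define x where "x = H k \<otimes> (Z k \<otimes> H k)"
      have xk: "x \<in> cliff_from k" and xc: "x \<in> carrier G"
        unfolding x_def using cliff_from_mult in_cliff_from(2)[of k k] k Hk Zk
          Z_in_cliff_fixing_Z[OF k] cliff_fixing_Z_subset[OF k] by auto
      have "conj_by (x \<otimes> g \<otimes> U) (Z k) = conj_by x (m \<otimes> Z k)"
        using gU c gc Uc xc Zk conj_by_comp[of x "g \<otimes> U" "Z k"] by (simp add: m_assoc)
      also have "\<dots> = Z k"
        using conj_by_HZH[OF k] xc Zk m unfolding x_def by (simp add: conj_phase_mult flip: m_assoc)
      finally show ?thesis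
        using cliff_from_mult[OF xk g(1)] by blast
    qed
    then obtain h where h: "h \<in> cliff_from k" "conj_by (h \<otimes> U) (Z k) = Z k"
      by blast
    have hc: "h \<in> carrier G" using cliff_from_carr[OF k1 h(1)] .
    have hU: "h \<otimes> U \<in> norm_pauli"
      using norm_pauli_mult cliff_from_normalizes[OF k1] h(1) less.prems by blast
    have "fixes_below (h \<otimes> U) k"
      using fixes_below_comp cliff_from_fixes_below h less.prems hc Uc by simp
    then obtain a where a: "a \<in> cliff_fixing_Z k" "fixes_below (a \<otimes> (h \<otimes> U)) (Suc k)"
      using fix_X_given_Z[OF hU _ k h(2)] by blast
    have ak: "a \<in> cliff_from k" using a(1) cliff_fixing_Z_subset[OF k] by blast
    have "a \<otimes> (h \<otimes> U) \<in> norm_pauli"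
      using norm_pauli_mult cliff_from_normalizes[OF k1] ak hU by blast
    then have "a \<otimes> (h \<otimes> U) \<in> cliff_from (Suc k)"
      using less.hyps[of "Suc k"] a(2) k by auto
    then have "a \<otimes> (h \<otimes> U) \<in> cliff_from k"
      using cliff_from_mono[of k "Suc k"] by auto
    then show ?thesis
      using cliff_from_cancel ak h(1) Uc hc k1 by (meson m_closed)
  qed
qed


lemma normalizer_fixing_Z:
  assumes k: "k \<in> {1..n}" and U: "U \<in> norm_pauli" "fixes_below U k" "conj_by U (Z k) = Z k"
  shows "U \<in> cliff_fixing_Z k"
proof -
  have Uc: "U \<in> carrier G" using U norm_pauli_carr by blast
  obtain a where a: "a \<in> cliff_fixing_Z k" "fixes_below (a \<otimes> U) (Suc k)"
    using fix_X_given_Z[OF U(1,2) k U(3)] by blast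
  have "a \<otimes> U \<in> norm_pauli"
    using norm_pauli_mult cliff_fixing_Z_normalizes[OF k] a U by blast
  then have "a \<otimes> U \<in> cliff_from (Suc k)"
    using normalizer_fixing_below[of "Suc k"] a(2) k by auto
  then show ?thesis
    using cliff_from_Suc_subset a(1) cliff_fixing_Z_cancel Uc k by blast
qed

section \<open>The stabilizer of the first Z up to phases\<close>

text \<open>The circuit \<open>h\<^sub>1 s\<^sub>1 h\<^sub>1 s\<^sub>1\<^sup>3 h\<^sub>1\<close>, with its gates in the order of matrix multiplication. As an
  operator it is \<open>X\<^sub>1 S\<^sub>1\<close> up to a phase and a power of \<open>Z\<^sub>1\<close>, which explains its action on
  \<open>Z\<^sub>1\<close>.\<close>
definition flip_gate :: 'a where
  "flip_gate = H 1 \<otimes> ((S 1 \<otimes> S 1 \<otimes> S 1) \<otimes> (H 1 \<otimes> (S 1 \<otimes> H 1)))"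

definition stab_gens :: "'a set" where
  "stab_gens = {flip_gate} \<union> H ` {2..n} \<union> S ` {2..n} \<union> C ` {1..<n}"

lemma flip_gate_normalizes: "1 \<le> n \<Longrightarrow> flip_gate \<in> norm_pauli"
  unfolding flip_gate_def using norm_pauli_mult H_normalizes S_normalizes by simp

lemma conj_flip_gate:
  assumes n: "1 \<le> n" shows "conj_by flip_gate (Z 1) = m \<otimes> Z 1"
proof -
  have k: "1 \<in> {1..n}" using n by simp
  note One_nat_def [simp del]
  note [simp] = carr(1)[OF k] carr(2)[OF k] carr(3)[OF k] carr(4)[OF k]
    and conj = conj_H[OF k] conj_S[OF k] conj_S_Z[OF k k] conj_S_XZ[OF k]
  have i: "\<iota> \<otimes> (\<iota> \<otimes> p) = m \<otimes> p" if "p \<in> carrier G" for p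
    using that iota by (simp flip: m_assoc)
  have mi: "m \<otimes> (\<iota> \<otimes> p) = \<iota> \<otimes> (m \<otimes> p)" if "p \<in> carrier G" for p
    using that phase_left_commute by simp
  have mm: "m \<otimes> (m \<otimes> p) = p" if "p \<in> carrier G" for p
    using that m by (simp flip: m_assoc)
  have 1: "conj_by (H 1 \<otimes> (S 1 \<otimes> H 1)) (Z 1) = \<iota> \<otimes> (m \<otimes> (X 1 \<otimes> Z 1))"
    using ZX[OF k] conj_by_mult[of "H 1" "X 1" "Z 1"]
    by (simp add: conj_by_comp conj conj_phase_mult)
  have 2: "conj_by (S 1 \<otimes> S 1 \<otimes> S 1) (X 1 \<otimes> Z 1) = \<iota> \<otimes> (m \<otimes> X 1)"
    by (simp add: conj_by_comp conj conj_phase_mult i mi)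
  have "conj_by (S 1 \<otimes> S 1 \<otimes> S 1) (\<iota> \<otimes> (m \<otimes> (X 1 \<otimes> Z 1))) = m \<otimes> X 1"
    using 2 by (simp add: conj_phase_mult i mi mm)
  then show ?thesis
    unfolding flip_gate_def using 1
    by (simp add: conj_by_comp[of "H 1"] conj_by_comp[of "S 1 \<otimes> S 1 \<otimes> S 1"] conj conj_phase_mult)
qed

lemma stab_gens_normalize:
  assumes n: "1 \<le> n" and g: "g \<in> insert (S 1) stab_gens"
  shows "g \<in> norm_pauli" "conj_by g (Z 1) = Z 1 \<or> conj_by g (Z 1) = m \<otimes> Z 1"
  using g n flip_gate_normalizes[OF n] H_normalizes S_normalizes C_normalizes
    conj_flip_gate conj_H_other conj_S_Z conj_C_Z
  unfolding stab_gens_def by auto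

lemma conj_Z_phase_subgroup:
  assumes n: "1 \<le> n"
  shows "subgroup {U \<in> norm_pauli. \<exists>c\<in>\<Phi>. conj_by U (Z 1) = c \<otimes> Z 1} G"
proof (rule subgroup.intro)
  have k: "1 \<in> {1..n}" using n by simp
  note Z1 = carr(2)[OF k]
  let ?A = "{U \<in> norm_pauli. \<exists>c\<in>\<Phi>. conj_by U (Z 1) = c \<otimes> Z 1}"
  show "?A \<subseteq> carrier G" using norm_pauli_carr by blast
  show "\<one> \<in> ?A"
    using Z1 subgroup.one_closed[OF norm_pauli_subgroup] by (auto intro!: bexI[of _ \<one>])
  show "U \<otimes> V \<in> ?A" if UV: "U \<in> ?A" "V \<in> ?A" for U V
  proof -
    obtain c d where "c \<in> \<Phi>" "conj_by V (Z 1) = c \<otimes> Z 1" "d \<in> \<Phi>" "conj_by U (Z 1) = d \<otimes> Z 1"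
      using UV by blast
    then have "conj_by (U \<otimes> V) (Z 1) = (c \<otimes> d) \<otimes> Z 1"
      using UV norm_pauli_carr Z1 by (intro conj_phase_eq_comp[of V U _ "Z 1"]) auto
    then show ?thesis using UV norm_pauli_mult \<open>c \<in> \<Phi>\<close> \<open>d \<in> \<Phi>\<close> phase_mult by blast
  qed
  show "inv U \<in> ?A" if U: "U \<in> ?A" for U
  proof -
    obtain c where c: "c \<in> \<Phi>" "conj_by U (Z 1) = c \<otimes> Z 1" and Uc: "U \<in> carrier G"
      using U norm_pauli_carr by blast
    have "Z 1 = c \<otimes> conj_by (inv U) (Z 1)"
      using conj_by_inv_eq[OF Uc Z1 c(2)] c Uc Z1 by (simp add: conj_phase_mult)
    then have "conj_by (inv U) (Z 1) = inv c \<otimes> Z 1"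
      using c(1) Uc Z1 by (metis inv_solve_left conj_by_closed inv_closed phase_carr)
    then show ?thesis
      using U c(1) subgroup.m_inv_closed[OF norm_pauli_subgroup] by auto
  qed
qed

text \<open>A product of \<open>C 1\<close>, \<open>H 2\<close> and \<open>S 2\<close> can act on qubit 1 as \<open>S 1\<close> does: \<open>C 1\<close> attaches
  \<open>Z 2\<close> to \<open>X 1\<close>; turn this factor into \<open>X 2\<close>, use \<open>C 1\<close> again to pick up both \<open>Z 1\<close> and \<open>Z 2\<close>, and clear qubit 2. What the product
  does to qubit 2 itself is irrelevant, since \<open>normalizer_fixing_below\<close> takes care of the
  difference.\<close>
lemma S1_redundant:
  assumes n: "2 \<le> n"
  shows "S 1 \<in> generate G (\<Phi> \<union> stab_gens)"
proof -
  have k: "1 \<in> {1..n}" "2 \<in> {1..n}" "1 \<in> {1..<n}" using n by auto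
  have s2: "Suc 1 = 2" by simp
  note One_nat_def [simp del]
  note [simp] = carr(1)[OF k(1)] carr(2)[OF k(1)] carr(3)[OF k(1)] carr(4)[OF k(1)]
    carr(1)[OF k(2)] carr(2)[OF k(2)] carr(3)[OF k(2)] carr(4)[OF k(2)] carr(5)[OF k(3)]
  note conj = conj_H[OF k(2)] conj_H_other[OF k(1,2)] conj_S_X[OF k(1,2)] conj_S_Z[OF k(1,2)]
    conj_S_Z[OF k(2,2)] conj_S_XZ[OF k(2)] conj_S[OF k(1)] conj_S_Z[OF k(1,1)]
    conj_C[OF k(3), unfolded s2] conj_C_Z[OF k(1,3)] conj_C_Z[OF k(2,3)]
    conj_C_XZ[OF k(3), unfolded s2]
  \<comment> \<open>Up to phases, and from right to left, the gates send \<open>X 1\<close> to \<open>X 1 Z 2\<close>, \<open>X 1 X 2\<close>,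
      \<open>X 1 Z 1 Z 2 X 2\<close>, \<open>X 1 Z 1 X 2 Z 2\<close>, \<open>X 1 Z 1 X 2\<close>, \<open>X 1 Z 1 Z 2\<close> and \<open>X 1 Z 1\<close>.\<close>
  define W where "W = C 1 \<otimes> (H 2 \<otimes> (S 2 \<otimes> (H 2 \<otimes> (C 1 \<otimes> (H 2 \<otimes> C 1)))))"
  have Wc [simp]: "W \<in> carrier G" unfolding W_def by simp
  let ?A = "generate G (\<Phi> \<union> stab_gens)"
  have "C 1 \<in> ?A" "H 2 \<in> ?A" "S 2 \<in> ?A"
    using n unfolding stab_gens_def by (auto intro!: generate.incl)
  then have WA: "W \<in> ?A"
    unfolding W_def by (intro generate.eng)
  have WN: "W \<in> norm_pauli"
    unfolding W_def using norm_pauli_mult C_normalizes[OF k(3)] H_normalizes[OF k(2)]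
      S_normalizes[OF k(2)] by simp
  have WZ: "conj_by W (Z 1) = Z 1"
    unfolding W_def by (simp add: conj_by_comp conj)
  have XZZX: "(X 1 \<otimes> Z 2) \<otimes> (Z 1 \<otimes> X 2) = X 1 \<otimes> (Z 1 \<otimes> (Z 2 \<otimes> X 2))"
    using Z_Z[OF k(2,1)] by (simp add: m_assoc) (simp flip: m_assoc)
  have "conj_by (H 2 \<otimes> (C 1 \<otimes> (H 2 \<otimes> C 1))) (X 1) = X 1 \<otimes> (Z 1 \<otimes> (X 2 \<otimes> Z 2))"
    by (simp add: conj_by_comp conj_by_mult conj XZZX)
  moreover have "conj_by (H 2 \<otimes> S 2) (X 1 \<otimes> (Z 1 \<otimes> (X 2 \<otimes> Z 2))) = \<iota> \<otimes> (X 1 \<otimes> (Z 1 \<otimes> Z 2))"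
    using conj_by_mult[of "S 2" "Z 1" "X 2 \<otimes> Z 2"] conj_by_mult[of "S 2" "X 1" "Z 1 \<otimes> (X 2 \<otimes> Z 2)"]
    by (simp add: conj_by_comp conj phase_left_commute conj_phase_mult)
       (simp add: conj_by_mult conj)
  moreover have "conj_by (C 1) (\<iota> \<otimes> (X 1 \<otimes> (Z 1 \<otimes> Z 2))) = \<iota> \<otimes> (X 1 \<otimes> Z 1)"
  proof -
    have "(X 1 \<otimes> Z 2) \<otimes> (Z 1 \<otimes> Z 2) = X 1 \<otimes> (Z 1 \<otimes> (Z 2 \<otimes> Z 2))"
      using Z_Z[OF k(2,1)] by (simp add: m_assoc) (simp flip: m_assoc)
    then show ?thesis
      using ZZ[OF k(2)] by (simp add: conj_phase_mult conj_by_mult conj)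
  qed
  ultimately have WX: "conj_by W (X 1) = \<iota> \<otimes> (X 1 \<otimes> Z 1)"
    unfolding W_def by (simp add: conj_by_comp)
  define V where "V = inv W \<otimes> S 1"
  have "conj_by V (X 1) = X 1" "conj_by V (Z 1) = Z 1"
    unfolding V_def using conj_by_inv_eq[OF Wc _ WX] conj_by_inv_eq[OF Wc _ WZ]
    by (simp_all add: conj_by_comp conj)
  then have "fixes_below V 2"
    unfolding fixes_below_def by (auto simp: le_less_Suc_eq numeral_2_eq_2 One_nat_def)
  moreover have "V \<in> norm_pauli"
    unfolding V_def using norm_pauli_mult WN S_normalizes[OF k(1)]
      subgroup.m_inv_closed[OF norm_pauli_subgroup] by simp
  ultimately have "V \<in> cliff_from 2"
    using normalizer_fixing_below[of 2 V] n by simp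
  moreover have "cliff_from 2 \<subseteq> ?A"
    unfolding cliff_from_def gates_from_def stab_gens_def by (intro mono_generate) auto
  moreover have "S 1 = W \<otimes> V"
    unfolding V_def by (simp flip: m_assoc)
  ultimately show ?thesis
    using WA generate.eng by (metis subsetD)
qed

text \<open>The possible phases are signs; \<open>flip_gate\<close> reduces to the case where \<open>Z 1\<close> is fixed, and there the
  second half of the sweep applies.\<close>
theorem stabilizer_of_Z1:
  assumes n: "1 \<le> n"
  shows "{U \<in> norm_pauli. \<exists>c\<in>\<Phi>. conj_by U (Z 1) = c \<otimes> Z 1}
       = generate G (\<Phi> \<union> insert (S 1) stab_gens)" (is "?L = ?R")
proof
  have k: "1 \<in> {1..n}" using n by simp
  note Z1 = carr(2)[OF k]
  have gens: "\<Phi> \<union> insert (S 1) stab_gens \<subseteq> ?L"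
  proof
    fix g assume "g \<in> \<Phi> \<union> insert (S 1) stab_gens"
    then show "g \<in> ?L"
    proof
      assume "g \<in> \<Phi>"
      then show ?thesis using phases_normalize conj_by_phase Z1 by (auto intro!: bexI[of _ \<one>])
    next
      assume "g \<in> insert (S 1) stab_gens"
      note * = stab_gens_normalize[OF n this]
      moreover have "\<exists>c\<in>\<Phi>. conj_by g (Z 1) = c \<otimes> Z 1"
        using *(2) Z1 l_one m_phase phase_one by metis
      ultimately show ?thesis by blast
    qed
  qed
  then show "?R \<subseteq> ?L"
    by (rule generate_subgroup_incl[OF _ conj_Z_phase_subgroup[OF n]])
  have gens_carr: "\<Phi> \<union> insert (S 1) stab_gens \<subseteq> carrier G"
    using gens norm_pauli_carr by blast
  have sub: "cliff_fixing_Z 1 \<subseteq> ?R"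
    unfolding cliff_fixing_Z_def gates_from_def stab_gens_def
    by (intro mono_generate) (auto simp: numeral_2_eq_2)
  have flip: "flip_gate \<in> ?R" unfolding stab_gens_def by (auto intro: generate.incl)
  note fc = norm_pauli_carr[THEN subsetD, OF flip_gate_normalizes[OF n]]
  show "?L \<subseteq> ?R"
  proof
    fix U assume U: "U \<in> ?L"
    then obtain c where c: "c \<in> \<Phi>" "conj_by U (Z 1) = c \<otimes> Z 1" by blast
    have Uc: "U \<in> carrier G" using U norm_pauli_carr by blast
    have 0: "fixes_below V 1" for V unfolding fixes_below_def by simp
    show "U \<in> ?R"
      using sign_of_conj[OF Uc Z1 ZZ[OF k] c Z1 ZZ[OF k]]
    proof
      assume "c = \<one>"
      then have "U \<in> cliff_fixing_Z 1"
        using normalizer_fixing_Z[OF k _ 0] U c Z1 by simp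
      then show ?thesis using sub by blast
    next
      assume cm: "c = m"
      have "conj_by (flip_gate \<otimes> U) (Z 1) = Z 1"
        using conj_flip_gate[OF n] cm c Uc fc Z1 m
        by (simp add: conj_by_comp conj_phase_mult flip: m_assoc)
      then have "flip_gate \<otimes> U \<in> cliff_fixing_Z 1"
        using normalizer_fixing_Z[OF k _ 0] U norm_pauli_mult flip_gate_normalizes[OF n] by blast
      then have "inv flip_gate \<otimes> (flip_gate \<otimes> U) \<in> ?R"
        using sub flip generate_m_inv_closed[OF gens_carr] generate.eng by (metis subsetD)
      then show ?thesis using Uc fc by (simp flip: m_assoc)
    qed
  qed
qed

end

section \<open>Passage to the projective group\<close>
lemma opposite_group_is_group:
  assumes "group G"
  shows "group (opposite_group G)"
proof -
  interpret group G by (rule assms)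
  show ?thesis
  proof (rule groupI)
    fix x assume "x \<in> carrier (opposite_group G)"
    then show "\<exists>y\<in>carrier (opposite_group G). y \<otimes>\<^bsub>opposite_group G\<^esub> x = \<one>\<^bsub>opposite_group G\<^esub>"
      using r_inv unfolding opposite_group_def by (auto intro!: bexI[of _ "inv\<^bsub>G\<^esub> x"])
  qed (auto simp: opposite_group_def m_assoc)
qed

text \<open>The same data as before; the type of the group is specialised to records without further
  fields, for which the quotient in circuit order is defined.\<close>
locale projective_clifford_gates = clifford_gates G n \<Phi> m \<iota> X Z H S C
  for G :: "'a monoid" (structure) and n \<Phi> m \<iota> X Z H S C
begin

abbreviation normalizer_group :: "'a monoid" where
  "normalizer_group \<equiv> G\<lparr>carrier := norm_pauli\<rparr>"

definition cls :: "'a \<Rightarrow> 'a set" where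
  "cls U = \<Phi> #>\<^bsub>normalizer_group\<^esub> U"

definition Proj :: "'a set monoid" where
  "Proj = opposite_group (normalizer_group Mod \<Phi>)"

lemma normalizer_group_is_group: "group normalizer_group"
  using subgroup_imp_group[OF norm_pauli_subgroup] .

lemma phases_normal: "\<Phi> \<lhd> normalizer_group"
proof (rule group.normal_invI[OF normalizer_group_is_group])
  show "subgroup \<Phi> normalizer_group"
    using subgroup_incl[OF phases norm_pauli_subgroup phases_normalize] .
  fix U c assume U: "U \<in> carrier normalizer_group" and c: "c \<in> \<Phi>"
  then have "U \<in> norm_pauli" "U \<in> carrier G" using norm_pauli_carr by auto
  then have "U \<otimes>\<^bsub>normalizer_group\<^esub> c \<otimes>\<^bsub>normalizer_group\<^esub> inv\<^bsub>normalizer_group\<^esub> U = conj_by U c"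
    unfolding conj_by_def using m_inv_consistent[OF norm_pauli_subgroup, of U] by simp
  then show "U \<otimes>\<^bsub>normalizer_group\<^esub> c \<otimes>\<^bsub>normalizer_group\<^esub> inv\<^bsub>normalizer_group\<^esub> U \<in> \<Phi>"
    using c \<open>U \<in> carrier G\<close> by simp
qed

lemma Proj_is_group: "group Proj"
  unfolding Proj_def
  using opposite_group_is_group normal.factorgroup_is_group[OF phases_normal] by blast

lemma carrier_Proj: "carrier Proj = cls ` norm_pauli"
  unfolding Proj_def opposite_group_def cls_def by (simp add: carrier_FactGroup)

lemma cls_in_Proj: "U \<in> norm_pauli \<Longrightarrow> cls U \<in> carrier Proj"
  using carrier_Proj by blast

lemma cls_mult:
  "U \<in> norm_pauli \<Longrightarrow> V \<in> norm_pauli \<Longrightarrow> cls U \<otimes>\<^bsub>Proj\<^esub> cls V = cls (V \<otimes> U)"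
  unfolding Proj_def opposite_group_def cls_def
  using normal.rcos_sum[OF phases_normal, of V U] by (simp add: FactGroup_def)

lemma cls_eq_iff:
  assumes U: "U \<in> norm_pauli" and V: "V \<in> norm_pauli"
  shows "cls U = cls V \<longleftrightarrow> (\<exists>c\<in>\<Phi>. U = c \<otimes> V)"
proof -
  note sub = normal_imp_subgroup[OF phases_normal]
  have "cls U = cls V \<longleftrightarrow> U \<in> cls V"
    using group.repr_independence[OF normalizer_group_is_group, of U \<Phi> V]
      group.rcos_self[OF normalizer_group_is_group, of U \<Phi>] U V sub
    unfolding cls_def by auto
  then show ?thesis unfolding cls_def r_coset_def by auto
qed

lemma cls_phase: "c \<in> \<Phi> \<Longrightarrow> cls c = \<one>\<^bsub>Proj\<^esub>"
  unfolding cls_def Proj_def opposite_group_def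
  using subgroup.rcos_const[OF normal_imp_subgroup[OF phases_normal] normalizer_group_is_group]
  by (simp add: FactGroup_def)

lemma cls_inv:
  assumes U: "U \<in> norm_pauli"
  shows "inv\<^bsub>Proj\<^esub> (cls U) = cls (inv U)"
proof -
  have i: "inv U \<in> norm_pauli" using U subgroup.m_inv_closed[OF norm_pauli_subgroup] by blast
  have "cls (inv U) \<otimes>\<^bsub>Proj\<^esub> cls U = \<one>\<^bsub>Proj\<^esub>"
    using cls_mult[OF i U] cls_phase[OF phase_one] U norm_pauli_carr by (simp add: subset_iff)
  then show ?thesis
    using group.inv_equality[OF Proj_is_group] cls_in_Proj U i by blast
qed

text \<open>The reversal of the order of multiplication does not affect which subgroup is generated.\<close>
lemma generate_Proj:
  assumes A: "A \<subseteq> norm_pauli"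
  shows "generate Proj (cls ` A) = cls ` generate G A"
proof
  have gen: "generate G A \<subseteq> norm_pauli"
    using generate_subgroup_incl[OF A norm_pauli_subgroup] .
  show "generate Proj (cls ` A) \<subseteq> cls ` generate G A"
  proof
    fix x assume "x \<in> generate Proj (cls ` A)"
    then show "x \<in> cls ` generate G A"
    proof induction
      case one
      then show ?case using cls_phase[OF phase_one] generate.one by (metis image_eqI)
    next
      case (incl h)
      then show ?case by (auto intro: generate.incl)
    next
      case (inv h)
      then show ?case using cls_inv A by (force intro: generate.inv)
    next
      case (eng h1 h2)
      then show ?case using cls_mult gen generate.eng by (smt (verit) imageE image_eqI subsetD)
    qed
  qed
  have "cls U \<in> generate Proj (cls ` A)" if "U \<in> generate G A" for U
    using that
  proof induction
    case one
    then show ?case using cls_phase[OF phase_one] generate.one by metis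
  next
    case (incl h)
    then show ?case by (auto intro: generate.incl)
  next
    case (inv h)
    then show ?case using cls_inv[of h] generate.inv[of "cls h" "cls ` A" Proj] A by auto
  next
    case (eng h1 h2)
    then have "cls (h1 \<otimes> h2) = cls h2 \<otimes>\<^bsub>Proj\<^esub> cls h1" using cls_mult gen by auto
    then show ?case using eng generate.eng by metis
  qed
  then show "cls ` generate G A \<subseteq> generate Proj (cls ` A)" by blast
qed

text \<open>The phases may be added to the generators upstairs, because their classes are trivial.\<close>
lemma generate_Proj_phases:
  assumes A: "A \<subseteq> norm_pauli"
  shows "generate Proj (cls ` A) = cls ` generate G (\<Phi> \<union> A)"
proof -
  have carr: "cls ` A \<subseteq> carrier Proj" using A cls_in_Proj by blast
  have "cls ` (\<Phi> \<union> A) \<subseteq> generate Proj (cls ` A)"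
    using cls_phase generate.one generate.incl by (fastforce intro: generate.one generate.incl)
  then have "generate Proj (cls ` (\<Phi> \<union> A)) \<subseteq> generate Proj (cls ` A)"
    using group.generate_subsetI[OF Proj_is_group] carr by blast
  moreover have "generate Proj (cls ` A) \<subseteq> generate Proj (cls ` (\<Phi> \<union> A))"
    by (rule group.mono_generate[OF Proj_is_group]) auto
  ultimately show ?thesis
    using generate_Proj[of "\<Phi> \<union> A"] A phases_normalize by simp
qed

text \<open>Commuting in the quotient means commuting up to a phase, that is, conjugating \<open>Z 1\<close> to a multiple of
  itself.\<close>
lemma centralizer_Z1:
  assumes n: "1 \<le> n"
  shows "centralizer Proj (cls (Z 1)) = cls ` {U \<in> norm_pauli. \<exists>c\<in>\<Phi>. conj_by U (Z 1) = c \<otimes> Z 1}"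
proof -
  have k: "1 \<in> {1..n}" using n by simp
  note Z1 = carr(2)[OF k]
  have ZN: "Z 1 \<in> norm_pauli"
    using SS[OF k] S_normalizes[OF k] norm_pauli_mult by metis
  have "cls (Z 1) \<otimes>\<^bsub>Proj\<^esub> cls U = cls U \<otimes>\<^bsub>Proj\<^esub> cls (Z 1)
      \<longleftrightarrow> (\<exists>c\<in>\<Phi>. conj_by U (Z 1) = c \<otimes> Z 1)" if U: "U \<in> norm_pauli" for U
  proof -
    have Uc: "U \<in> carrier G" using U norm_pauli_carr by blast
    have "cls (Z 1) \<otimes>\<^bsub>Proj\<^esub> cls U = cls U \<otimes>\<^bsub>Proj\<^esub> cls (Z 1)
        \<longleftrightarrow> (\<exists>c\<in>\<Phi>. U \<otimes> Z 1 = c \<otimes> (Z 1 \<otimes> U))"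
      using cls_mult U ZN cls_eq_iff norm_pauli_mult by simp
    also have "\<dots> \<longleftrightarrow> (\<exists>c\<in>\<Phi>. conj_by U (Z 1) = c \<otimes> Z 1)"
      using Uc Z1 by (intro bex_cong refl) (simp add: conj_by_eq_iff m_assoc)
    finally show ?thesis .
  qed
  then show ?thesis
    unfolding centralizer_def carrier_Proj by auto
qed

theorem centralizer_S1_squared:
  assumes n: "1 \<le> n"
  shows "centralizer Proj (cls (S 1) [^]\<^bsub>Proj\<^esub> (2::nat)) = generate Proj (cls ` insert (S 1) stab_gens)"
    and "2 \<le> n \<Longrightarrow>
      centralizer Proj (cls (S 1) [^]\<^bsub>Proj\<^esub> (2::nat)) = generate Proj (cls ` stab_gens)"
proof -
  interpret Proj: group Proj by (rule Proj_is_group)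
  have k: "1 \<in> {1..n}" using n by simp
  have SN: "S 1 \<in> norm_pauli" using S_normalizes[OF k] .
  have "cls (S 1) [^]\<^bsub>Proj\<^esub> (2::nat) = cls (Z 1)"
    using cls_mult[OF SN SN] SS[OF k] cls_in_Proj[OF SN] by (simp add: numeral_2_eq_2)
  then have *: "centralizer Proj (cls (S 1) [^]\<^bsub>Proj\<^esub> (2::nat))
      = cls ` generate G (\<Phi> \<union> insert (S 1) stab_gens)"
    using centralizer_Z1[OF n] stabilizer_of_Z1[OF n] by simp
  have gens: "insert (S 1) stab_gens \<subseteq> norm_pauli"
    using stab_gens_normalize(1)[OF n] by blast
  show "centralizer Proj (cls (S 1) [^]\<^bsub>Proj\<^esub> (2::nat)) = generate Proj (cls ` insert (S 1) stab_gens)"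
    using * generate_Proj_phases[OF gens] by simp
  assume n2: "2 \<le> n"
  have carr': "\<Phi> \<union> stab_gens \<subseteq> carrier G" 
    using gens norm_pauli_carr phases_normalize by blast
  have "generate G (\<Phi> \<union> insert (S 1) stab_gens) = generate G (\<Phi> \<union> stab_gens)"
  proof
    show "generate G (\<Phi> \<union> insert (S 1) stab_gens) \<subseteq> generate G (\<Phi> \<union> stab_gens)"
      using S1_redundant[OF n2] by (intro generate_subsetI[OF _ carr']) (auto intro: generate.incl)
    show "generate G (\<Phi> \<union> stab_gens) \<subseteq> generate G (\<Phi> \<union> insert (S 1) stab_gens)"
      by (intro mono_generate) auto
  qed
  then show "centralizer Proj (cls (S 1) [^]\<^bsub>Proj\<^esub> (2::nat)) = generate Proj (cls ` stab_gens)"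
    using * generate_Proj_phases[of stab_gens] gens by simp
qed

lemma cls_flip_gate:
  assumes n: "1 \<le> n"
  shows "cls (H 1) \<otimes>\<^bsub>Proj\<^esub> cls (S 1) \<otimes>\<^bsub>Proj\<^esub> cls (H 1) \<otimes>\<^bsub>Proj\<^esub> (cls (S 1) [^]\<^bsub>Proj\<^esub> (3::nat))
      \<otimes>\<^bsub>Proj\<^esub> cls (H 1) = cls flip_gate"
proof -
  interpret Proj: group Proj by (rule Proj_is_group)
  have k: "1 \<in> {1..n}" using n by simp
  note N = S_normalizes[OF k] H_normalizes[OF k]
  have "cls (S 1) [^]\<^bsub>Proj\<^esub> (3::nat) = cls (S 1 \<otimes> (S 1 \<otimes> S 1))"
    using N cls_in_Proj cls_mult norm_pauli_mult by (simp add: numeral_3_eq_3)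
  then show ?thesis
    unfolding flip_gate_def using N cls_mult norm_pauli_mult carr k by (simp add: m_assoc)
qed

end

section \<open>Kronecker products\<close>

lemma dim_kron [simp]:
  "dim_row (kron A B) = dim_row A * dim_row B" "dim_col (kron A B) = dim_col A * dim_col B"
  by (simp_all add: kron_def)

lemma kron_carrier [simp, intro]:
  "A \<in> carrier_mat a b \<Longrightarrow> B \<in> carrier_mat c d \<Longrightarrow> kron A B \<in> carrier_mat (a * c) (b * d)"
  by (intro carrier_matI) (simp_all add: carrier_matD)

lemma index_kron:
  "i < dim_row A * dim_row B \<Longrightarrow> j < dim_col A * dim_col B \<Longrightarrow>
    kron A B $$ (i, j) = A $$ (i div dim_row B, j div dim_col B) * B $$ (i mod dim_row B, j mod dim_col B)"
  by (simp add: kron_def)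

lemma less_mult_div_mod:
  fixes i a b :: nat
  assumes "i < a * b"
  shows "i div b < a" "i mod b < b"
proof -
  have "0 < b" using assms by (cases b) auto
  then show "i div b < a" "i mod b < b" using assms by (simp_all add: less_mult_imp_div_less)
qed

text \<open>A row or column index of a Kronecker product encodes a pair of indices by quotient and
  remainder; this splits sums over such indices.\<close>
lemma sum_div_mod:
  fixes f :: "nat \<Rightarrow> nat \<Rightarrow> 'a::comm_monoid_add"
  shows "(\<Sum>k<b * d. f (k div d) (k mod d)) = (\<Sum>x<b. \<Sum>y<d. f x y)"
proof -
  have "(\<Sum>x<b. \<Sum>y<d. f x y) = (\<Sum>(x, y)\<in>{..<b} \<times> {..<d}. f x y)"
    by (rule sum.cartesian_product)
  also have "\<dots> = (\<Sum>k<b * d. f (k div d) (k mod d))"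
  proof (rule sum.reindex_bij_witness[where i = "\<lambda>k. (k div d, k mod d)" and j = "\<lambda>(x, y). x * d + y"])
    fix p assume "p \<in> {..<b} \<times> {..<d}"
    then obtain x y where p: "p = (x, y)" "x < b" "y < d" by auto
    have "x * d + y < Suc x * d" using p by simp
    also have "\<dots> \<le> b * d" using p by (intro mult_le_mono1) simp
    finally show "(case p of (x, y) \<Rightarrow> x * d + y) \<in> {..<b * d}" using p by simp
  qed (auto simp: less_mult_div_mod)
  finally show ?thesis by simp
qed

lemma kron_mult_kron:
  assumes A: "A \<in> carrier_mat a b" and B: "B \<in> carrier_mat c d"
    and C: "C \<in> carrier_mat b e" and D: "D \<in> carrier_mat d f"
  shows "kron A B * kron C D = kron (A * C) (B * D)"
proof (rule eq_matI)
  show "dim_row (kron A B * kron C D) = dim_row (kron (A * C) (B * D))"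
    "dim_col (kron A B * kron C D) = dim_col (kron (A * C) (B * D))"
    using assms by auto
  fix i j assume "i < dim_row (kron (A * C) (B * D))" "j < dim_col (kron (A * C) (B * D))"
  then have ij: "i < a * c" "j < e * f" using assms by auto
  note lt = less_mult_div_mod[OF ij(1)] less_mult_div_mod[OF ij(2)]
  have "(kron A B * kron C D) $$ (i, j)
      = (\<Sum>k<b * d. (A $$ (i div c, k div d) * C $$ (k div d, j div f))
            * (B $$ (i mod c, k mod d) * D $$ (k mod d, j mod f)))"
    using assms ij by (auto simp: scalar_prod_def index_kron lessThan_atLeast0 intro!: sum.cong)
  also have "\<dots> = (\<Sum>x<b. \<Sum>y<d. (A $$ (i div c, x) * C $$ (x, j div f))
            * (B $$ (i mod c, y) * D $$ (y, j mod f)))"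
    by (rule sum_div_mod)
  also have "\<dots> = (A * C) $$ (i div c, j div f) * (B * D) $$ (i mod c, j mod f)"
    using assms lt by (simp add: scalar_prod_def lessThan_atLeast0 sum_product)
  also have "\<dots> = kron (A * C) (B * D) $$ (i, j)"
    using assms ij by (simp add: index_kron)
  finally show "(kron A B * kron C D) $$ (i, j) = kron (A * C) (B * D) $$ (i, j)" .
qed

lemma kron_assoc: "kron (kron A B) C = kron A (kron B C)"
proof (rule eq_matI)
  fix i j assume "i < dim_row (kron A (kron B C))" "j < dim_col (kron A (kron B C))"
  then have ij: "i < dim_row A * (dim_row B * dim_row C)" "j < dim_col A * (dim_col B * dim_col C)"
    by auto
  then have ij': "i < dim_row A * dim_row B * dim_row C" "j < dim_col A * dim_col B * dim_col C"
    by (simp_all add: mult.assoc)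
  note lt = less_mult_div_mod[OF ij(1)] less_mult_div_mod[OF ij(2)]
    less_mult_div_mod[OF ij'(1)] less_mult_div_mod[OF ij'(2)]
  have dm: "i div c div b = i div (b * c)" "i div c mod b = i mod (b * c) div c"
    "i mod c = i mod (b * c) mod c" if "0 < c" for i b c :: nat
    using that by (simp_all add: div_mult2_eq mult.commute[of b c] mod_mult2_eq mod_mod_cancel)
  have pos: "0 < dim_row C" "0 < dim_col C"
    using ij by (auto intro!: Nat.gr0I)
  show "kron (kron A B) C $$ (i, j) = kron A (kron B C) $$ (i, j)"
    using ij ij' lt by (simp add: index_kron dm[OF pos(1)] dm[OF pos(2)] mod_mod_cancel)
qed auto

lemma kron_one: "kron (1\<^sub>m a) (1\<^sub>m b) = 1\<^sub>m (a * b)"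
proof (rule eq_matI)
  fix i j assume "i < dim_row (1\<^sub>m (a * b) :: complex mat)" "j < dim_col (1\<^sub>m (a * b) :: complex mat)"
  then have ij: "i < a * b" "j < a * b" by auto
  have "i div b = j div b \<and> i mod b = j mod b \<longleftrightarrow> i = j"
    by (metis div_mult_mod_eq)
  then show "kron (1\<^sub>m a) (1\<^sub>m b) $$ (i, j) = 1\<^sub>m (a * b) $$ (i, j)"
    using ij less_mult_div_mod[OF ij(1)] less_mult_div_mod[OF ij(2)] by (auto simp: index_kron)
qed auto

lemma kron_smult_left: "kron (c \<cdot>\<^sub>m A) B = c \<cdot>\<^sub>m kron A B"
  by (rule eq_matI) (auto simp: index_kron less_mult_div_mod)

lemma kron_smult_right: "kron A (c \<cdot>\<^sub>m B) = c \<cdot>\<^sub>m kron A B"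
  by (rule eq_matI) (auto simp: index_kron less_mult_div_mod)

lemma dim_mat_adjoint [simp]:
  "dim_row (mat_adjoint A) = dim_col A" "dim_col (mat_adjoint A) = dim_row A"
  unfolding mat_adjoint_def by auto

lemma mat_adjoint_carrier [simp, intro]:
  "A \<in> carrier_mat d d \<Longrightarrow> mat_adjoint A \<in> carrier_mat d d"
  by (intro carrier_matI) auto

lemma index_mat_adjoint [simp]:
  "i < dim_col A \<Longrightarrow> j < dim_row A \<Longrightarrow> mat_adjoint A $$ (i, j) = conjugate (A $$ (j, i))"
  unfolding mat_adjoint_def by (auto simp: mat_of_rows_def)

lemma mat_adjoint_mult:
  fixes A B :: "complex mat"
  assumes "dim_col A = dim_row B"
  shows "mat_adjoint (A * B) = mat_adjoint B * mat_adjoint A"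
  using assms by (intro eq_matI) (auto simp: scalar_prod_def mult.commute intro!: sum.cong)

lemma mat_adjoint_adjoint: "mat_adjoint (mat_adjoint A) = (A :: complex mat)"
  by (intro eq_matI) auto

lemma mat_adjoint_kron: "mat_adjoint (kron A B) = kron (mat_adjoint A) (mat_adjoint B)"
  by (intro eq_matI) (auto simp: index_kron less_mult_div_mod)

lemma mat_adjoint_one: "mat_adjoint (1\<^sub>m d :: complex mat) = 1\<^sub>m d"
  by (intro eq_matI) auto

lemma mat_adjoint_smult_one: "mat_adjoint (c \<cdot>\<^sub>m 1\<^sub>m d :: complex mat) = cnj c \<cdot>\<^sub>m 1\<^sub>m d"
  by (intro eq_matI) auto

section \<open>The unitary group\<close>

lemma unitary_group_simps [simp]:
  "U \<otimes>\<^bsub>unitary_group d\<^esub> V = U * V" "\<one>\<^bsub>unitary_group d\<^esub> = 1\<^sub>m d"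
  by (simp_all add: unitary_group_def)

lemma in_unitary_group:
  "U \<in> carrier (unitary_group d) \<longleftrightarrow>
     U \<in> carrier_mat d d \<and> mat_adjoint U * U = 1\<^sub>m d \<and> U * mat_adjoint U = 1\<^sub>m d"
  by (simp add: unitary_group_def)

lemma unitary_group_is_group: "group (unitary_group d)"
proof (rule groupI)
  fix U V assume "U \<in> carrier (unitary_group d)" "V \<in> carrier (unitary_group d)"
  then have UV: "U \<in> carrier_mat d d" "V \<in> carrier_mat d d" 
    and u: "mat_adjoint U * U = 1\<^sub>m d" "U * mat_adjoint U = 1\<^sub>m d"
    and v: "mat_adjoint V * V = 1\<^sub>m d" "V * mat_adjoint V = 1\<^sub>m d"
    by (auto simp: in_unitary_group)
  note c = UV mat_adjoint_carrier[OF UV(1)] mat_adjoint_carrier[OF UV(2)]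
  have assoc4: "A * B * (C * D) = A * (B * C) * D"
    if "A \<in> carrier_mat d d" "B \<in> carrier_mat d d" "C \<in> carrier_mat d d" "D \<in> carrier_mat d d"
    for A B C D :: "complex mat"
    using that by (simp add: assoc_mult_mat[of _ d d _ d _ d])
  have "mat_adjoint V * mat_adjoint U * (U * V) = mat_adjoint V * (mat_adjoint U * U) * V"
    using c by (intro assoc4)
  moreover have "U * V * (mat_adjoint V * mat_adjoint U) = U * (V * mat_adjoint V) * mat_adjoint U"
    using c by (intro assoc4)
  ultimately show "U \<otimes>\<^bsub>unitary_group d\<^esub> V \<in> carrier (unitary_group d)"
    using c u v by (simp add: in_unitary_group mat_adjoint_mult)
next
  show "\<one>\<^bsub>unitary_group d\<^esub> \<in> carrier (unitary_group d)"
    by (simp add: in_unitary_group mat_adjoint_one)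
next
  fix U assume U: "U \<in> carrier (unitary_group d)"
  then show "\<one>\<^bsub>unitary_group d\<^esub> \<otimes>\<^bsub>unitary_group d\<^esub> U = U" by (auto simp: in_unitary_group)
  show "\<exists>V\<in>carrier (unitary_group d). V \<otimes>\<^bsub>unitary_group d\<^esub> U = \<one>\<^bsub>unitary_group d\<^esub>"
    using U by (intro bexI[of _ "mat_adjoint U"]) (auto simp: in_unitary_group mat_adjoint_adjoint)
next
  fix U V W
  assume "U \<in> carrier (unitary_group d)" "V \<in> carrier (unitary_group d)" "W \<in> carrier (unitary_group d)"
  then show "U \<otimes>\<^bsub>unitary_group d\<^esub> V \<otimes>\<^bsub>unitary_group d\<^esub> W
      = U \<otimes>\<^bsub>unitary_group d\<^esub> (V \<otimes>\<^bsub>unitary_group d\<^esub> W)"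
    using assoc_mult_mat by (auto simp: in_unitary_group)
qed

lemma smult_smult: "a \<cdot>\<^sub>m (b \<cdot>\<^sub>m A) = (a * b) \<cdot>\<^sub>m (A :: complex mat)"
  by (rule eq_matI) auto

lemma one_smult: "1 \<cdot>\<^sub>m A = (A :: complex mat)"
  by (rule eq_matI) auto

lemma smult_one_mult: "dim_row U = d \<Longrightarrow> (c \<cdot>\<^sub>m 1\<^sub>m d) * U = c \<cdot>\<^sub>m (U :: complex mat)"
  by (metis carrier_matI left_mult_one_mat mult_smult_assoc_mat one_carrier_mat)

lemma mult_smult_one: "dim_col U = d \<Longrightarrow> U * (c \<cdot>\<^sub>m 1\<^sub>m d) = c \<cdot>\<^sub>m (U :: complex mat)"
  by (metis carrier_matI right_mult_one_mat mult_smult_distrib one_carrier_mat)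

lemma smult_one_unitary: "cmod c = 1 \<Longrightarrow> c \<cdot>\<^sub>m 1\<^sub>m d \<in> carrier (unitary_group d)"
  using complex_norm_square[of c]
  by (simp add: in_unitary_group mat_adjoint_smult_one smult_one_mult smult_smult one_smult mult.commute)

lemma global_phases_subgroup: "subgroup (global_phases n) (unitary_group (2 ^ n))"
proof -
  interpret group "unitary_group (2 ^ n)" by (rule unitary_group_is_group)
  have inv: "inv\<^bsub>unitary_group (2 ^ n)\<^esub> (c \<cdot>\<^sub>m 1\<^sub>m (2 ^ n)) = cnj c \<cdot>\<^sub>m 1\<^sub>m (2 ^ n)" if "cmod c = 1" for c
    using that complex_norm_square[of c]
    by (intro inv_equality smult_one_unitary)
       (simp_all add: smult_one_mult smult_smult one_smult mult.commute)
  show ?thesis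
  proof (rule subgroup.intro)
    show "global_phases n \<subseteq> carrier (unitary_group (2 ^ n))"
      unfolding global_phases_def using smult_one_unitary by auto
    show "\<one>\<^bsub>unitary_group (2 ^ n)\<^esub> \<in> global_phases n"
      unfolding global_phases_def by (auto intro!: exI[of _ 1] eq_matI)
    fix x assume "x \<in> global_phases n"
    then obtain c where c: "x = c \<cdot>\<^sub>m 1\<^sub>m (2 ^ n)" "cmod c = 1" unfolding global_phases_def by auto
    then show "inv\<^bsub>unitary_group (2 ^ n)\<^esub> x \<in> global_phases n"
      using inv unfolding global_phases_def by (auto intro!: exI[of _ "cnj c"])
    fix y assume "y \<in> global_phases n"
    then obtain d where d: "y = d \<cdot>\<^sub>m 1\<^sub>m (2 ^ n)" "cmod d = 1" unfolding global_phases_def by auto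
    show "x \<otimes>\<^bsub>unitary_group (2 ^ n)\<^esub> y \<in> global_phases n"
      using c d unfolding global_phases_def
      by (auto intro!: exI[of _ "c * d"] simp: smult_one_mult smult_smult norm_mult)
  qed
qed

section \<open>Operators on a block of qubits\<close>

text \<open>\<open>V\<close> acts on the middle factor of a triple tensor product whose outer factors have dimensions \<open>a\<close>
  and \<open>b\<close>. Arbitrary dimensions allow the same operator to be regrouped, which is how gates on
  one qubit and gates on two neighbouring qubits are compared.\<close>
definition embed :: "nat \<Rightarrow> complex mat \<Rightarrow> nat \<Rightarrow> complex mat" where
  "embed a V b = kron (kron (1\<^sub>m a) V) (1\<^sub>m b)"

lemma embed_carrier: "V \<in> carrier_mat v v \<Longrightarrow> embed a V b \<in> carrier_mat (a * v * b) (a * v * b)"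
  unfolding embed_def by (intro kron_carrier) auto

lemma embed_mult:
  assumes "V \<in> carrier_mat v v" "W \<in> carrier_mat v v"
  shows "embed a V b * embed a W b = embed a (V * W) b"
proof -
  have "embed a V b * embed a W b = kron (kron (1\<^sub>m a) V * kron (1\<^sub>m a) W) (1\<^sub>m b * 1\<^sub>m b)"
    unfolding embed_def using assms
    by (intro kron_mult_kron[where b = "a * v" and d = b]) (auto intro!: kron_carrier)
  also have "kron (1\<^sub>m a) V * kron (1\<^sub>m a) W = kron (1\<^sub>m a * 1\<^sub>m a) (V * W)"
    using assms by (intro kron_mult_kron[where b = a and d = v]) auto
  finally show ?thesis unfolding embed_def by simp
qed

lemma embed_one: "embed a (1\<^sub>m v) b = 1\<^sub>m (a * v * b)"
  unfolding embed_def by (simp add: kron_one)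

lemma embed_smult: "embed a (c \<cdot>\<^sub>m V) b = c \<cdot>\<^sub>m embed a V b"
  unfolding embed_def by (simp add: kron_smult_left kron_smult_right)

lemma embed_adjoint: "mat_adjoint (embed a V b) = embed a (mat_adjoint V) b"
  unfolding embed_def by (simp add: mat_adjoint_kron mat_adjoint_one)

lemma embed_unitary:
  assumes "V \<in> carrier (unitary_group v)"
  shows "embed a V b \<in> carrier (unitary_group (a * v * b))"
proof -
  have V: "V \<in> carrier_mat v v" using assms by (simp add: in_unitary_group)
  show ?thesis
    using assms embed_carrier[OF V]
    by (simp add: in_unitary_group embed_adjoint embed_mult[OF V mat_adjoint_carrier[OF V]]
        embed_mult[OF mat_adjoint_carrier[OF V] V] embed_one)
qed

lemma embed_kron_one_right:
  "embed a (kron V (1\<^sub>m c)) b = embed a V (c * b)"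
  unfolding embed_def by (simp add: kron_assoc flip: kron_one)

lemma embed_kron_one_left:
  "embed a (kron (1\<^sub>m c) V) b = embed (a * c) V b"
  unfolding embed_def by (simp add: kron_assoc flip: kron_one)

text \<open>Operators on disjoint blocks, with \<open>e\<close> the dimension between them: after regrouping, the first acts
  on the left and the second on the right factor of one Kronecker product.\<close>
lemma embed_commute:
  assumes V: "V \<in> carrier_mat v v" and W: "W \<in> carrier_mat u u"
  shows "embed a V (e * u * b) * embed (a * v * e) W b = embed (a * v * e) W b * embed a V (e * u * b)"
proof -
  have 1: "embed a V (e * u * b) = kron (kron (1\<^sub>m a) V) (1\<^sub>m (e * u * b))"
    unfolding embed_def ..
  have 2: "embed (a * v * e) W b = kron (1\<^sub>m (a * v)) (embed e W b)"
    unfolding embed_def by (simp add: kron_assoc flip: kron_one)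
  have c: "kron (1\<^sub>m a) V \<in> carrier_mat (a * v) (a * v)"
    "embed e W b \<in> carrier_mat (e * u * b) (e * u * b)"
    using V embed_carrier[OF W] by auto
  show ?thesis
    unfolding 1 2 kron_mult_kron[OF c(1) one_carrier_mat one_carrier_mat c(2)]
        kron_mult_kron[OF one_carrier_mat c(2) c(1) one_carrier_mat]
    using left_mult_one_mat[OF c(1)] right_mult_one_mat[OF c(1)]
      left_mult_one_mat[OF c(2)] right_mult_one_mat[OF c(2)] by simp
qed

lemma index_embed:
  assumes V: "V \<in> carrier_mat v v" and ij: "i < a * v * b" "j < a * v * b"
  shows "embed a V b $$ (i, j) =
    (if i div (v * b) = j div (v * b) \<and> i mod b = j mod b
     then V $$ (i div b mod v, j div b mod v) else 0)"
proof -
  note 1 = less_mult_div_mod[OF ij(1)] less_mult_div_mod[OF ij(2)]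
  note 2 = less_mult_div_mod[OF 1(1)] less_mult_div_mod[OF 1(3)]
  have "i div b div v = i div (v * b)" for i by (simp add: div_mult2_eq mult.commute)
  then show ?thesis
    using 1 2 V ij unfolding embed_def by (auto simp: index_kron)
qed

section \<open>The elementary gates\<close>

lemma gate_carrier [simp]:
  "mat_X \<in> carrier_mat 2 2" "mat_Z \<in> carrier_mat 2 2" "mat_H \<in> carrier_mat 2 2"
  "mat_S w \<in> carrier_mat 2 2" "mat_CZ \<in> carrier_mat 4 4"
  by (auto simp: mat_X_def mat_Z_def mat_H_def mat_S_def mat_CZ_def mat_of_rows_list_def)

lemma nat_less_2_iff: "i < (2::nat) \<longleftrightarrow> i = 0 \<or> i = 1" by auto

lemma nat_less_4_iff: "i < (4::nat) \<longleftrightarrow> i = 0 \<or> i = 1 \<or> i = 2 \<or> i = 3" by auto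

lemma nat_less_4E:
  assumes "i < (4::nat)"
  obtains "i = 0" | "i = 1" | "i = 2" | "i = 3"
  using assms by linarith

lemma index_gates:
  "mat_X $$ (0, 0) = 0" "mat_X $$ (0, Suc 0) = 1" "mat_X $$ (Suc 0, 0) = 1" "mat_X $$ (Suc 0, Suc 0) = 0"
  "mat_Z $$ (0, 0) = 1" "mat_Z $$ (0, Suc 0) = 0" "mat_Z $$ (Suc 0, 0) = 0" "mat_Z $$ (Suc 0, Suc 0) = -1"
  "mat_H $$ (0, 0) = 1 / complex_of_real (sqrt 2)" "mat_H $$ (0, Suc 0) = 1 / complex_of_real (sqrt 2)"
  "mat_H $$ (Suc 0, 0) = 1 / complex_of_real (sqrt 2)" "mat_H $$ (Suc 0, Suc 0) = - (1 / complex_of_real (sqrt 2))"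
  "mat_S w $$ (0, 0) = 1" "mat_S w $$ (0, Suc 0) = 0" "mat_S w $$ (Suc 0, 0) = 0" "mat_S w $$ (Suc 0, Suc 0) = w ^ 2"
  by (simp_all add: mat_X_def mat_Z_def mat_H_def mat_S_def mat_of_rows_list_def)

lemma dim_gates [simp]:
  "dim_row mat_X = 2" "dim_col mat_X = 2" "dim_row mat_Z = 2" "dim_col mat_Z = 2"
  "dim_row mat_H = 2" "dim_col mat_H = 2" "dim_row (mat_S w) = 2" "dim_col (mat_S w) = 2"
  "dim_row mat_CZ = 4" "dim_col mat_CZ = 4"
  using gate_carrier by blast+

lemma eq_mat2I:
  assumes "dim_row A = 2" "dim_col A = 2" "dim_row B = 2" "dim_col B = 2"
    and "A $$ (0, 0) = B $$ (0, 0)" "A $$ (0, Suc 0) = B $$ (0, Suc 0)"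
    "A $$ (Suc 0, 0) = B $$ (Suc 0, 0)" "A $$ (Suc 0, Suc 0) = B $$ (Suc 0, Suc 0)"
  shows "A = B"
  using assms by (intro eq_matI) (auto simp: nat_less_2_iff)

lemma mult_mat2:
  assumes "dim_row A = 2" "dim_col A = 2" "dim_row B = 2" "dim_col B = 2" "i < 2" "j < 2"
  shows "(A * B) $$ (i, j) = A $$ (i, 0) * B $$ (0, j) + A $$ (i, Suc 0) * B $$ (Suc 0, j)"
  using assms by (auto simp: scalar_prod_def numeral_2_eq_2)

lemmas mat2_simps = mult_mat2[of _ _ 0] mult_mat2[of _ _ "Suc 0"] index_gates

lemma inverse_sqrt2: "1 / complex_of_real (sqrt 2) * (1 / complex_of_real (sqrt 2)) = 1 / 2"
  by (simp flip: of_real_mult)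

lemma one_qubit_relations:
  "mat_X * mat_X = 1\<^sub>m 2" "mat_Z * mat_Z = 1\<^sub>m 2" "mat_Z * mat_X = (-1) \<cdot>\<^sub>m (mat_X * mat_Z)"
  "mat_H * mat_X = mat_Z * mat_H" "mat_H * mat_Z = mat_X * mat_H"
  "mat_S w * mat_Z = mat_Z * mat_S w"
  by - (rule eq_mat2I; simp add: mat2_simps del: index_mult_mat(1))+

lemma mat_S_relations:
  assumes "w ^ 4 = -1"
  shows "mat_S w * mat_S w = mat_Z" "mat_S w * mat_X = (w ^ 2 \<cdot>\<^sub>m (mat_X * mat_Z)) * mat_S w"
proof -
  have "w ^ 2 * w ^ 2 = -1" using assms by (simp flip: power_add)
  then show "mat_S w * mat_S w = mat_Z" "mat_S w * mat_X = (w ^ 2 \<cdot>\<^sub>m (mat_X * mat_Z)) * mat_S w"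
    by - (rule eq_mat2I; simp add: mat2_simps del: index_mult_mat(1))+
qed

lemma one_qubit_unitary:
  "mat_X \<in> carrier (unitary_group 2)" "mat_Z \<in> carrier (unitary_group 2)"
  "mat_H \<in> carrier (unitary_group 2)" "cmod w = 1 \<Longrightarrow> mat_S w \<in> carrier (unitary_group 2)"
proof -
  show "mat_X \<in> carrier (unitary_group 2)" "mat_Z \<in> carrier (unitary_group 2)"
    by (auto simp: in_unitary_group mat2_simps simp del: index_mult_mat(1) intro!: eq_mat2I)
  show "mat_H \<in> carrier (unitary_group 2)"
    using inverse_sqrt2 by (auto simp: in_unitary_group mat2_simps simp del: index_mult_mat(1) intro!: eq_mat2I)
  assume "cmod w = 1"
  then have "w * cnj w = 1" using complex_norm_square[of w] by simp
  then have "w ^ 2 * cnj w ^ 2 = 1" by (simp flip: power_mult_distrib)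
  then show "mat_S w \<in> carrier (unitary_group 2)"
    by (auto simp: in_unitary_group mat2_simps mult.commute simp del: index_mult_mat(1) intro!: eq_mat2I)
qed

lemma index_CZ: "i < 4 \<Longrightarrow> j < 4 \<Longrightarrow> mat_CZ $$ (i, j) = (if i = j then if i = 3 then -1 else 1 else 0)"
  by (auto simp: nat_less_4_iff mat_CZ_def mat_of_rows_list_def)

lemma mult_mat_single_term:
  fixes A B :: "complex mat"
  assumes "A \<in> carrier_mat d d" "B \<in> carrier_mat d d" "r < d" "c < d" "l < d"
    and "\<And>k. k < d \<Longrightarrow> k \<noteq> l \<Longrightarrow> A $$ (r, k) = 0 \<or> B $$ (k, c) = 0"
  shows "(A * B) $$ (r, c) = A $$ (r, l) * B $$ (l, c)"
proof -
  have "(A * B) $$ (r, c) = (\<Sum>k\<in>{0..<d}. A $$ (r, k) * B $$ (k, c))"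
    using assms(1-4) by (simp add: scalar_prod_def)
  also have "\<dots> = (\<Sum>k\<in>{0..<d}. if k = l then A $$ (r, l) * B $$ (l, c) else 0)"
    using assms(6) by (intro sum.cong) auto
  finally show ?thesis using assms(5) by simp
qed

lemma CZ_mult:
  assumes "A \<in> carrier_mat 4 4" "i < 4" "j < 4"
  shows "(mat_CZ * A) $$ (i, j) = (if i = 3 then - A $$ (i, j) else A $$ (i, j))"
    "(A * mat_CZ) $$ (i, j) = (if j = 3 then - A $$ (i, j) else A $$ (i, j))"
proof -
  have "(mat_CZ * A) $$ (i, j) = mat_CZ $$ (i, i) * A $$ (i, j)"
    using assms by (intro mult_mat_single_term[of _ 4]) (auto simp: index_CZ)
  then show "(mat_CZ * A) $$ (i, j) = (if i = 3 then - A $$ (i, j) else A $$ (i, j))"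
    using assms by (simp add: index_CZ del: index_mult_mat(1))
  have "(A * mat_CZ) $$ (i, j) = A $$ (i, j) * mat_CZ $$ (j, j)"
    using assms by (intro mult_mat_single_term[of _ 4]) (auto simp: index_CZ)
  then show "(A * mat_CZ) $$ (i, j) = (if j = 3 then - A $$ (i, j) else A $$ (i, j))"
    using assms by (simp add: index_CZ del: index_mult_mat(1))
qed

lemma kron_carrier_4:
  "A \<in> carrier_mat 2 2 \<Longrightarrow> B \<in> carrier_mat 2 2 \<Longrightarrow> kron A B \<in> carrier_mat 4 4"
  using kron_carrier[of A 2 2 B 2 2] by simp

text \<open>\<open>mat_CZ\<close> is diagonal, so multiplying by it on the left or right rescales rows or columns, and the
  relation can be read off entry by entry.\<close>
lemma CZ_commute_kron:
  assumes AB: "A \<in> carrier_mat 2 2" "B \<in> carrier_mat 2 2" and CD: "C \<in> carrier_mat 2 2" "D \<in> carrier_mat 2 2"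
    and "\<And>i j. i < 4 \<Longrightarrow> j < 4 \<Longrightarrow>
      (if i = 3 then -1 else 1) * (A $$ (i div 2, j div 2) * B $$ (i mod 2, j mod 2))
      = (if j = 3 then -1 else 1) * (C $$ (i div 2, j div 2) * D $$ (i mod 2, j mod 2))"
  shows "mat_CZ * kron A B = kron C D * mat_CZ"
proof (rule eq_matI)
  note c = kron_carrier_4[OF AB] kron_carrier_4[OF CD] gate_carrier(5)
  show "dim_row (mat_CZ * kron A B) = dim_row (kron C D * mat_CZ)"
    "dim_col (mat_CZ * kron A B) = dim_col (kron C D * mat_CZ)"
    using carrier_matD[OF c(1)] carrier_matD[OF c(2)] by (simp_all del: dim_kron)
  fix i j assume "i < dim_row (kron C D * mat_CZ)" "j < dim_col (kron C D * mat_CZ)"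
  then have "i < 4" "j < 4" using c carrier_matD[OF c(2)] carrier_matD[OF c(3)] by auto
  then show "(mat_CZ * kron A B) $$ (i, j) = (kron C D * mat_CZ) $$ (i, j)"
    using assms(5)[of i j] AB CD by (auto simp: CZ_mult[OF c(1)] CZ_mult[OF c(2)] index_kron
        simp del: index_mult_mat(1) split: if_splits)
qed

lemma CZ_relations:
  "mat_CZ * kron mat_X (1\<^sub>m 2) = kron mat_X mat_Z * mat_CZ"
  "mat_CZ * kron (1\<^sub>m 2) mat_X = kron mat_Z mat_X * mat_CZ"
  "mat_CZ * kron mat_Z (1\<^sub>m 2) = kron mat_Z (1\<^sub>m 2) * mat_CZ"
  "mat_CZ * kron (1\<^sub>m 2) mat_Z = kron (1\<^sub>m 2) mat_Z * mat_CZ"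
proof -
  note c = gate_carrier one_carrier_mat
  show "mat_CZ * kron mat_X (1\<^sub>m 2) = kron mat_X mat_Z * mat_CZ"
    by (rule CZ_commute_kron[OF c(1) c(6) c(1,2)]; erule nat_less_4E; erule nat_less_4E; simp add: index_gates)
  show "mat_CZ * kron (1\<^sub>m 2) mat_X = kron mat_Z mat_X * mat_CZ"
    by (rule CZ_commute_kron[OF c(6) c(1) c(2,1)]; erule nat_less_4E; erule nat_less_4E; simp add: index_gates)
  show "mat_CZ * kron mat_Z (1\<^sub>m 2) = kron mat_Z (1\<^sub>m 2) * mat_CZ"
    by (rule CZ_commute_kron[OF c(2) c(6) c(2,6)]; erule nat_less_4E; erule nat_less_4E; simp add: index_gates)
  show "mat_CZ * kron (1\<^sub>m 2) mat_Z = kron (1\<^sub>m 2) mat_Z * mat_CZ"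
    by (rule CZ_commute_kron[OF c(6) c(2) c(6,2)]; erule nat_less_4E; erule nat_less_4E; simp add: index_gates)
qed

lemma CZ_unitary: "mat_CZ \<in> carrier (unitary_group 4)"
proof -
  have "mat_adjoint mat_CZ = mat_CZ"
    by (intro eq_matI) (auto simp: index_CZ)
  moreover have "mat_CZ * mat_CZ = 1\<^sub>m 4"
    by (intro eq_matI) (auto simp: CZ_mult[OF gate_carrier(5)] index_CZ simp del: index_mult_mat(1))
  ultimately show ?thesis by (simp add: in_unitary_group)
qed

section \<open>Gates on n qubits\<close>

lemma on_qubit_embed: "on_qubit n i U = embed (2 ^ (i - 1)) U (2 ^ (n - i))"
  by (simp add: on_qubit_def embed_def)

lemma CZ_gate_embed: "CZ_gate n i = embed (2 ^ (i - 1)) mat_CZ (2 ^ (n - i - 1))"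
  by (simp add: CZ_gate_def embed_def)

lemma qubit_dims:
  assumes "i \<in> {1..n}"
  shows "2 ^ (i - 1) * 2 * 2 ^ (n - i) = (2 ^ n :: nat)"
proof -
  have "(2::nat) ^ (i - 1) * 2 * 2 ^ (n - i) = 2 ^ (i - 1 + 1 + (n - i))"
    by (simp only: power_add power_one_right)
  also have "i - 1 + 1 + (n - i) = n" using assms by auto
  finally show ?thesis .
qed

lemma pair_dims:
  assumes "i \<in> {1..<n}"
  shows "2 ^ (i - 1) * 4 * 2 ^ (n - i - 1) = (2 ^ n :: nat)"
proof -
  have "(2::nat) ^ (i - 1) * 4 * 2 ^ (n - i - 1) = 2 ^ (i - 1 + 2 + (n - i - 1))"
    by (simp only: power_add) simp
  also have "i - 1 + 2 + (n - i - 1) = n" using assms by auto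
  finally show ?thesis .
qed

lemma on_qubit_mult:
  assumes "U \<in> carrier_mat 2 2" "V \<in> carrier_mat 2 2"
  shows "on_qubit n i U * on_qubit n i V = on_qubit n i (U * V)"
  unfolding on_qubit_embed using embed_mult[OF assms] .

lemma on_qubit_unitary:
  "i \<in> {1..n} \<Longrightarrow> U \<in> carrier (unitary_group 2) \<Longrightarrow> on_qubit n i U \<in> carrier (unitary_group (2 ^ n))"
  using embed_unitary[of U 2 "2 ^ (i - 1)" "2 ^ (n - i)"] qubit_dims[of i n]
  unfolding on_qubit_embed by simp

lemma CZ_gate_unitary: "i \<in> {1..<n} \<Longrightarrow> CZ_gate n i \<in> carrier (unitary_group (2 ^ n))"
  using embed_unitary[OF CZ_unitary, of "2 ^ (i - 1)" "2 ^ (n - i - 1)"] pair_dims[of i n]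
  unfolding CZ_gate_embed by simp

lemma on_qubit_carrier:
  "i \<in> {1..n} \<Longrightarrow> U \<in> carrier_mat 2 2 \<Longrightarrow> on_qubit n i U \<in> carrier_mat (2 ^ n) (2 ^ n)"
  using embed_carrier[of U 2 "2 ^ (i - 1)" "2 ^ (n - i)"] qubit_dims[of i n]
  unfolding on_qubit_embed by simp

lemma on_qubit_one: "i \<in> {1..n} \<Longrightarrow> on_qubit n i (1\<^sub>m 2) = 1\<^sub>m (2 ^ n)"
  unfolding on_qubit_embed embed_one using qubit_dims[of i n] by simp

lemma on_qubit_smult: "on_qubit n i (c \<cdot>\<^sub>m U) = c \<cdot>\<^sub>m on_qubit n i U"
  unfolding on_qubit_embed by (rule embed_smult)

lemma on_qubit_commute:
  assumes U: "U \<in> carrier_mat 2 2" and V: "V \<in> carrier_mat 2 2"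
    and ij: "i \<in> {1..n}" "j \<in> {1..n}" "i \<noteq> j"
  shows "on_qubit n i U * on_qubit n j V = on_qubit n j V * on_qubit n i U"
proof -
  have *: "on_qubit n i U * on_qubit n j V = on_qubit n j V * on_qubit n i U"
    if "U \<in> carrier_mat 2 2" "V \<in> carrier_mat 2 2" "i < j" "1 \<le> i" "j \<le> n" for U V i j
  proof -
    have "n - i = (j - i - 1) + 1 + (n - j)" "j - 1 = (i - 1) + 1 + (j - i - 1)" using that by auto
    then have "(2::nat) ^ (n - i) = 2 ^ (j - i - 1) * 2 * 2 ^ (n - j)"
      "(2::nat) ^ (j - 1) = 2 ^ (i - 1) * 2 * 2 ^ (j - i - 1)"
      by (simp_all only: power_add power_one_right)
    then show ?thesis
      unfolding on_qubit_embed
      using embed_commute[OF that(1,2), of "2 ^ (i - 1)" "2 ^ (j - i - 1)" "2 ^ (n - j)"] by simp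
  qed
  show ?thesis using *[of U V i j] *[of V U j i] assms by (cases "i < j") auto
qed

lemma CZ_gate_commute:
  assumes U: "U \<in> carrier_mat 2 2" and ij: "i \<in> {1..n}" "j \<in> {1..<n}" "i \<noteq> j" "i \<noteq> Suc j"
  shows "CZ_gate n j * on_qubit n i U = on_qubit n i U * CZ_gate n j"
proof (cases "i < j")
  case True
  have "n - i = (j - i - 1) + 2 + (n - j - 1)" "j - 1 = (i - 1) + 1 + (j - i - 1)" using True ij by auto
  then have "(2::nat) ^ (n - i) = 2 ^ (j - i - 1) * 2 ^ 2 * 2 ^ (n - j - 1)"
    "(2::nat) ^ (j - 1) = 2 ^ (i - 1) * 2 * 2 ^ (j - i - 1)"
    by (simp_all only: power_add power_one_right)
  then show ?thesis
    unfolding on_qubit_embed CZ_gate_embed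
    using embed_commute[OF U gate_carrier(5), of "2 ^ (i - 1)" "2 ^ (j - i - 1)" "2 ^ (n - j - 1)"] by simp
next
  case False
  then have "n - j - 1 = (i - j - 2) + 1 + (n - i)" "i - 1 = (j - 1) + 2 + (i - j - 2)" using ij by auto
  then have "(2::nat) ^ (n - j - 1) = 2 ^ (i - j - 2) * 2 * 2 ^ (n - i)"
    "(2::nat) ^ (i - 1) = 2 ^ (j - 1) * 2 ^ 2 * 2 ^ (i - j - 2)"
    by (simp_all only: power_add power_one_right)
  then show ?thesis
    unfolding on_qubit_embed CZ_gate_embed
    using embed_commute[OF gate_carrier(5) U, of "2 ^ (j - 1)" "2 ^ (i - j - 2)" "2 ^ (n - i)"] by simp
qed

text \<open>Two neighbouring qubits form one block of dimension 4, so relations between \<open>mat_CZ\<close> and operators on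
  one of the two qubits become relations of 4 by 4 matrices.\<close>
lemma on_qubit_pair:
  assumes "i \<in> {1..<n}"
  shows "on_qubit n i U = embed (2 ^ (i - 1)) (kron U (1\<^sub>m 2)) (2 ^ (n - i - 1))"
    "on_qubit n (Suc i) U = embed (2 ^ (i - 1)) (kron (1\<^sub>m 2) U) (2 ^ (n - i - 1))"
proof -
  have "n - i = 1 + (n - i - 1)" "i = (i - 1) + 1" using assms by auto
  then have "(2::nat) ^ (n - i) = 2 * 2 ^ (n - i - 1)" "(2::nat) ^ i = 2 ^ (i - 1) * 2"
    by (metis power_add power_one_right)+
  then show "on_qubit n i U = embed (2 ^ (i - 1)) (kron U (1\<^sub>m 2)) (2 ^ (n - i - 1))"
    "on_qubit n (Suc i) U = embed (2 ^ (i - 1)) (kron (1\<^sub>m 2) U) (2 ^ (n - i - 1))"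
    unfolding on_qubit_embed embed_kron_one_left embed_kron_one_right by simp_all
qed

lemma CZ_gate_relations:
  assumes i: "i \<in> {1..<n}"
  shows "CZ_gate n i * on_qubit n i mat_X = (on_qubit n i mat_X * on_qubit n (Suc i) mat_Z) * CZ_gate n i"
    "CZ_gate n i * on_qubit n (Suc i) mat_X = (on_qubit n i mat_Z * on_qubit n (Suc i) mat_X) * CZ_gate n i"
    "CZ_gate n i * on_qubit n i mat_Z = on_qubit n i mat_Z * CZ_gate n i"
    "CZ_gate n i * on_qubit n (Suc i) mat_Z = on_qubit n (Suc i) mat_Z * CZ_gate n i"
proof -
  have k: "kron A (1\<^sub>m 2) * kron (1\<^sub>m 2) B = kron A B"
    if "A \<in> carrier_mat 2 2" "B \<in> carrier_mat 2 2" for A B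
    using kron_mult_kron[OF that(1) one_carrier_mat one_carrier_mat that(2)] that by simp
  note c = kron_carrier_4 gate_carrier one_carrier_mat
  note m = embed_mult[where v = 4]
  show "CZ_gate n i * on_qubit n i mat_X = (on_qubit n i mat_X * on_qubit n (Suc i) mat_Z) * CZ_gate n i"
    "CZ_gate n i * on_qubit n (Suc i) mat_X = (on_qubit n i mat_Z * on_qubit n (Suc i) mat_X) * CZ_gate n i"
    "CZ_gate n i * on_qubit n i mat_Z = on_qubit n i mat_Z * CZ_gate n i"
    "CZ_gate n i * on_qubit n (Suc i) mat_Z = on_qubit n (Suc i) mat_Z * CZ_gate n i"
    unfolding on_qubit_pair[OF i] CZ_gate_embed by (simp_all add: m c k CZ_relations)
qed

section \<open>Schurs lemma for the Pauli group\<close>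

text \<open>In these entries \<open>r div 2 ^ (n - i) mod 2\<close> is the binary digit of \<open>r\<close> that belongs to qubit \<open>i\<close>;
  qubit 1 is the most significant one.\<close>
lemma index_on_qubit:
  assumes "i \<in> {1..n}" "U \<in> carrier_mat 2 2" "r < 2 ^ n" "c < 2 ^ n"
  shows "on_qubit n i U $$ (r, c) =
    (if r div (2 * 2 ^ (n - i)) = c div (2 * 2 ^ (n - i)) \<and> r mod 2 ^ (n - i) = c mod 2 ^ (n - i)
     then U $$ (r div 2 ^ (n - i) mod 2, c div 2 ^ (n - i) mod 2) else 0)"
  unfolding on_qubit_embed using index_embed[OF assms(2)] assms qubit_dims[of i n] by simp

lemma exists_differing_bit:
  fixes r c :: nat
  assumes "r \<noteq> c" "r < 2 ^ n" "c < 2 ^ n"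
  shows "\<exists>p<n. odd (r div 2 ^ p) \<noteq> odd (c div 2 ^ p)"
proof -
  obtain p where p: "bit r p \<noteq> bit c p" using assms(1) bit_eq_iff by blast
  have "p < n"
  proof (rule ccontr)
    assume "\<not> p < n"
    then have "(2::nat) ^ n \<le> 2 ^ p" by simp
    then have "r < 2 ^ p" "c < 2 ^ p" using assms(2,3) by (meson order_less_le_trans)+
    then show False using p by (simp add: bit_iff_odd)
  qed
  then show ?thesis using p by (auto simp: bit_iff_odd)
qed

lemma index_on_qubit_Z:
  assumes "i \<in> {1..n}" "r < 2 ^ n" "c < 2 ^ n"
  shows "on_qubit n i mat_Z $$ (r, c) = (if r = c then if odd (r div 2 ^ (n - i)) then -1 else 1 else 0)"
proof -
  let ?b = "2 ^ (n - i) :: nat"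
  have eq: "r = c" if "r div (2 * ?b) = c div (2 * ?b)" "r mod ?b = c mod ?b"
    "r div ?b mod 2 = c div ?b mod 2"
  proof -
    have "x = (x div (2 * ?b) * 2 + x div ?b mod 2) * ?b + x mod ?b" for x
      by (metis div_mult2_eq div_mult_mod_eq mult.commute)
    then show ?thesis using that by metis
  qed
  have Z: "mat_Z $$ (x mod 2, y mod 2) = (if x mod 2 = y mod 2 then if odd x then -1 else 1 else 0)"
    for x y :: nat
    using index_gates(5-8) by (cases "even x"; cases "even y") (auto simp: mod2_eq_if)
  show ?thesis
    using index_on_qubit[OF assms(1) gate_carrier(2) assms(2,3)] eq by (auto simp: Z)
qed

lemma index_on_qubit_X:
  assumes i: "i \<in> {1..n}" and r: "r < 2 ^ n" "odd (r div 2 ^ (n - i))"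
  shows "2 ^ (n - i) \<le> r" "on_qubit n i mat_X $$ (r, r - 2 ^ (n - i)) = 1"
proof -
  let ?b = "2 ^ (n - i) :: nat"
  obtain q where q: "r div ?b = 2 * q + 1" using r(2) by (auto elim: oddE)
  then have rq: "r = (2 * q + 1) * ?b + r mod ?b" by (metis div_mult_mod_eq)
  then show le: "?b \<le> r" by (metis le_add1 le_add2 mult_le_mono1 nat_mult_1 order_trans)
  define s where "s = r mod ?b"
  have s: "s < ?b" unfolding s_def by simp
  have "r - ?b = 2 * q * ?b + s" using rq unfolding s_def by (simp add: algebra_simps)
  then have c: "(r - ?b) div ?b = 2 * q" "(r - ?b) mod ?b = s" using s by simp_all
  have "r div (2 * ?b) = q" "(r - ?b) div (2 * ?b) = q"
    using q c(1) div_mult2_eq[of _ ?b 2] by (simp_all add: mult.commute)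
  moreover have "r div ?b mod 2 = Suc 0" "(r - ?b) div ?b mod 2 = 0" "r mod ?b = s"
    using q c(1) s_def by simp_all
  moreover have "r - ?b < 2 ^ n" using r(1) by simp
  ultimately show "on_qubit n i mat_X $$ (r, r - ?b) = 1"
    using index_on_qubit[OF i gate_carrier(1) r(1), of "r - ?b"] c(2) index_gates(3)
    by (simp only: simp_thms if_True)
qed

text \<open>Two different indices differ in some binary digit, so commuting with the corresponding Z forces the
  entry at these indices to vanish. Commuting with X identifies diagonal entries whose indices differ in one
  digit; clearing digits one by one leads to index 0.\<close>
lemma commutes_with_Paulis_imp_scalar:
  assumes U: "U \<in> carrier_mat (2 ^ n) (2 ^ n)"
    and X: "\<And>i. i \<in> {1..n} \<Longrightarrow> U * on_qubit n i mat_X = on_qubit n i mat_X * U"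
    and Z: "\<And>i. i \<in> {1..n} \<Longrightarrow> U * on_qubit n i mat_Z = on_qubit n i mat_Z * U"
  shows "U = U $$ (0, 0) \<cdot>\<^sub>m 1\<^sub>m (2 ^ n)"
proof -
  have off: "U $$ (r, c) = 0" if rc: "r < 2 ^ n" "c < 2 ^ n" "r \<noteq> c" for r c
  proof -
    obtain p where p: "p < n" "odd (r div 2 ^ p) \<noteq> odd (c div 2 ^ p)"
      using exists_differing_bit[OF rc(3,1,2)] by blast
    define i where "i = n - p"
    have i: "i \<in> {1..n}" "n - i = p" unfolding i_def using p by auto
    define z :: "nat \<Rightarrow> complex" where "z k = (if odd (k div 2 ^ p) then -1 else 1)" for k
    have zi: "on_qubit n i mat_Z $$ (k, l) = (if k = l then z k else 0)" if "k < 2 ^ n" "l < 2 ^ n" for k l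
      using index_on_qubit_Z[OF i(1) that] i(2) unfolding z_def by simp
    note Zc = on_qubit_carrier[OF i(1) gate_carrier(2)]
    have "(U * on_qubit n i mat_Z) $$ (r, c) = U $$ (r, c) * z c"
      using mult_mat_single_term[OF U Zc rc(1,2,2)] zi rc by auto
    moreover have "(on_qubit n i mat_Z * U) $$ (r, c) = z r * U $$ (r, c)"
      using mult_mat_single_term[OF Zc U rc(1,2,1)] zi rc by auto
    ultimately have "U $$ (r, c) * z c = z r * U $$ (r, c)"
      using Z[OF i(1)] by metis
    then show ?thesis using p(2) unfolding z_def by (auto split: if_splits)
  qed
  have diag: "U $$ (r, r) = U $$ (0, 0)" if "r < 2 ^ n" for r
    using that
  proof (induction r rule: less_induct)
    case (less r)
    show ?case
    proof (cases "r = 0")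
      case False
      obtain p where p: "p < n" "odd (r div 2 ^ p)"
        using exists_differing_bit[OF False less.prems] by auto
      define i where "i = n - p"
      have i: "i \<in> {1..n}" "n - i = p" unfolding i_def using p by auto
      define c where "c = r - 2 ^ p"
      have Xrc: "on_qubit n i mat_X $$ (r, c) = 1" and c: "c < r"
        using index_on_qubit_X[OF i(1) less.prems] p i(2) False unfolding c_def by simp_all
      note Xc = on_qubit_carrier[OF i(1) gate_carrier(1)]
      have rc: "r < 2 ^ n" "c < 2 ^ n" using less.prems c by auto
      have "(U * on_qubit n i mat_X) $$ (r, c) = U $$ (r, r)"
        using mult_mat_single_term[OF U Xc rc(1,2,1)] off rc Xrc by auto
      moreover have "(on_qubit n i mat_X * U) $$ (r, c) = U $$ (c, c)"
        using mult_mat_single_term[OF Xc U rc(1,2,2)] off rc Xrc by auto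
      ultimately have "U $$ (r, r) = U $$ (c, c)"
        using X[OF i(1)] by simp
      then show ?thesis using less.IH[OF c] rc by simp
    qed simp
  qed
  show ?thesis
  proof (rule eq_matI)
    fix i j assume "i < dim_row (U $$ (0, 0) \<cdot>\<^sub>m 1\<^sub>m (2 ^ n))" "j < dim_col (U $$ (0, 0) \<cdot>\<^sub>m 1\<^sub>m (2 ^ n))"
    then have ij: "i < 2 ^ n" "j < 2 ^ n" by simp_all
    then show "U $$ (i, j) = (U $$ (0, 0) \<cdot>\<^sub>m 1\<^sub>m (2 ^ n)) $$ (i, j)"
      using off[OF ij] diag[OF ij(2)] by (cases "i = j") simp_all
  qed (use U in auto)
qed

lemma unitary_scalar_phase:
  assumes "c \<cdot>\<^sub>m 1\<^sub>m d \<in> carrier (unitary_group d)" "0 < d"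
  shows "cmod c = 1"
proof -
  have "(cnj c * c) \<cdot>\<^sub>m 1\<^sub>m d = (1\<^sub>m d :: complex mat)"
    using assms(1) by (simp add: in_unitary_group mat_adjoint_smult_one smult_one_mult smult_smult)
  then have "((cnj c * c) \<cdot>\<^sub>m 1\<^sub>m d) $$ (0, 0) = (1\<^sub>m d :: complex mat) $$ (0, 0)" by simp
  then have "c * cnj c = 1" using assms(2) by (simp add: mult.commute)
  then have "(cmod c) ^ 2 = 1"
    using complex_norm_square[of c] by (metis of_real_eq_1_iff)
  then show ?thesis by (simp add: power2_eq_1_iff) (metis norm_ge_zero one_neq_neg_one neg_0_le_iff_le not_one_le_zero)
qed

section \<open>The centralizer in the projective Clifford group\<close>

lemma primitive_8th_root_power4:
  assumes "primitive_8th_root w"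
  shows "w ^ 4 = -1" "cmod w = 1"
proof -
  have w: "w ^ 8 = 1" "w ^ 4 \<noteq> 1" using assms unfolding primitive_8th_root_def by auto
  have "(w ^ 4) ^ 2 = 1" using w(1) by (simp flip: power_mult)
  then show "w ^ 4 = -1" using w(2) power2_eq_1_iff[of "w ^ 4"] by blast
  have "cmod w ^ 8 = 1" using w(1) by (metis norm_one norm_power)
  then show "cmod w = 1" using power_eq_1_iff[of "cmod w" 8] by simp
qed


lemma qubit_gates:
  assumes w: "primitive_8th_root w"
  shows "projective_clifford_gates (unitary_group (2 ^ n)) n (global_phases n)
    ((-1) \<cdot>\<^sub>m 1\<^sub>m (2 ^ n)) (w ^ 2 \<cdot>\<^sub>m 1\<^sub>m (2 ^ n))
    (\<lambda>i. on_qubit n i mat_X) (\<lambda>i. on_qubit n i mat_Z) (\<lambda>i. on_qubit n i mat_H)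
    (\<lambda>i. on_qubit n i (mat_S w)) (CZ_gate n)"
proof -
  note w4 = primitive_8th_root_power4[OF w]
  let ?G = "unitary_group (2 ^ n)"
  interpret group ?G by (rule unitary_group_is_group)
  note g = gate_carrier
  note rel = one_qubit_relations mat_S_relations[OF w4(1)]
  note mult = on_qubit_mult[OF g(1,1)] on_qubit_mult[OF g(2,2)] on_qubit_mult[OF g(1,2)]
    on_qubit_mult[OF g(2,1)] on_qubit_mult[OF g(3,1)] on_qubit_mult[OF g(3,2)]
    on_qubit_mult[OF g(1,3)] on_qubit_mult[OF g(2,3)] on_qubit_mult[OF g(4,4)]
    on_qubit_mult[OF g(4,1)] on_qubit_mult[OF g(4,2)] on_qubit_mult[OF g(2,4)]
  have dims: "dim_row (on_qubit n i U) = 2 ^ n" "dim_col (on_qubit n i U) = 2 ^ n"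
    if "i \<in> {1..n}" "U \<in> carrier_mat 2 2" for i U
    using on_qubit_carrier[OF that] by auto
  show ?thesis
  proof (intro projective_clifford_gates.intro clifford_gates.intro clifford_gates_axioms.intro,
      unfold unitary_group_simps)
    show "group ?G" by (rule unitary_group_is_group)
    show "subgroup (global_phases n) ?G" by (rule global_phases_subgroup)
    show "c * U = U * c" if "c \<in> global_phases n" "U \<in> carrier ?G" for c U
      using that unfolding global_phases_def
      by (auto simp: in_unitary_group smult_one_mult mult_smult_one)
    show "w ^ 2 \<cdot>\<^sub>m 1\<^sub>m (2 ^ n) \<in> global_phases n"
      unfolding global_phases_def using w4(2) by (auto simp: norm_power)
    show "(w ^ 2 \<cdot>\<^sub>m 1\<^sub>m (2 ^ n)) * (w ^ 2 \<cdot>\<^sub>m 1\<^sub>m (2 ^ n)) = (-1) \<cdot>\<^sub>m 1\<^sub>m (2 ^ n)"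
      using w4(1) by (simp add: smult_one_mult smult_smult flip: power_add)
    show "(-1) \<cdot>\<^sub>m 1\<^sub>m (2 ^ n) \<noteq> (1\<^sub>m (2 ^ n) :: complex mat)"
    proof
      assume "(-1) \<cdot>\<^sub>m 1\<^sub>m (2 ^ n) = (1\<^sub>m (2 ^ n) :: complex mat)"
      then have "((-1) \<cdot>\<^sub>m 1\<^sub>m (2 ^ n)) $$ (0, 0) = (1\<^sub>m (2 ^ n) :: complex mat) $$ (0, 0)" by simp
      then show False by simp
    qed
    show "((-1) \<cdot>\<^sub>m 1\<^sub>m (2 ^ n)) * ((-1) \<cdot>\<^sub>m 1\<^sub>m (2 ^ n)) = (1\<^sub>m (2 ^ n) :: complex mat)"
      by (simp add: smult_one_mult smult_smult one_smult)
    show "c = 1\<^sub>m (2 ^ n) \<or> c = (-1) \<cdot>\<^sub>m 1\<^sub>m (2 ^ n)" 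
      if c: "c \<in> global_phases n" "c * c = 1\<^sub>m (2 ^ n)" for c
    proof -
      obtain a where a: "c = a \<cdot>\<^sub>m 1\<^sub>m (2 ^ n)" using c(1) unfolding global_phases_def by auto
      have "(a * a) \<cdot>\<^sub>m 1\<^sub>m (2 ^ n) = (1\<^sub>m (2 ^ n) :: complex mat)"
        using c(2) a by (simp add: smult_one_mult smult_smult)
      then have "((a * a) \<cdot>\<^sub>m 1\<^sub>m (2 ^ n)) $$ (0, 0) = (1\<^sub>m (2 ^ n) :: complex mat) $$ (0, 0)" by simp
      then have "a = 1 \<or> a = -1" by (simp add: square_eq_1_iff)
      then show ?thesis using a one_smult by auto
    qed
    show "U \<in> global_phases n"
      if U: "U \<in> carrier ?G" and "\<And>j. j \<in> {1..n} \<Longrightarrow>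
        U * on_qubit n j mat_X = on_qubit n j mat_X * U \<and> U * on_qubit n j mat_Z = on_qubit n j mat_Z * U"
      for U
    proof -
      have *: "U = U $$ (0, 0) \<cdot>\<^sub>m 1\<^sub>m (2 ^ n)"
        using commutes_with_Paulis_imp_scalar[of U n] that by (auto simp: in_unitary_group)
      then have "cmod (U $$ (0, 0)) = 1"
        using unitary_scalar_phase[of "U $$ (0, 0)" "2 ^ n"] U by simp
      then show ?thesis using * unfolding global_phases_def by blast
    qed
    fix j assume j: "j \<in> {1..n}"
    show "on_qubit n j mat_X \<in> carrier ?G" "on_qubit n j mat_Z \<in> carrier ?G"
      "on_qubit n j mat_H \<in> carrier ?G" "on_qubit n j (mat_S w) \<in> carrier ?G"
      using j one_qubit_unitary w4(2) on_qubit_unitary by auto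
    show "on_qubit n j mat_X * on_qubit n j mat_X = 1\<^sub>m (2 ^ n)"
      "on_qubit n j mat_Z * on_qubit n j mat_Z = 1\<^sub>m (2 ^ n)"
      "on_qubit n j mat_H * on_qubit n j mat_X = on_qubit n j mat_Z * on_qubit n j mat_H"
      "on_qubit n j mat_H * on_qubit n j mat_Z = on_qubit n j mat_X * on_qubit n j mat_H"
      "on_qubit n j (mat_S w) * on_qubit n j (mat_S w) = on_qubit n j mat_Z"
      using j by (simp_all only: mult rel on_qubit_one)
    show "on_qubit n j mat_Z * on_qubit n j mat_X
        = (-1) \<cdot>\<^sub>m 1\<^sub>m (2 ^ n) * (on_qubit n j mat_X * on_qubit n j mat_Z)"
      using dims[OF j mult_carrier_mat[OF g(1,2)]]
      by (simp add: smult_one_mult mult rel on_qubit_smult)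
    show "on_qubit n j (mat_S w) * on_qubit n j mat_X
        = w ^ 2 \<cdot>\<^sub>m 1\<^sub>m (2 ^ n) * (on_qubit n j mat_X * on_qubit n j mat_Z) * on_qubit n j (mat_S w)"
    proof -
      have "w ^ 2 \<cdot>\<^sub>m 1\<^sub>m (2 ^ n) * (on_qubit n j mat_X * on_qubit n j mat_Z) = on_qubit n j (w ^ 2 \<cdot>\<^sub>m (mat_X * mat_Z))"
        using dims[OF j g(1)] by (simp add: smult_one_mult mult[symmetric] on_qubit_smult)
      then show ?thesis
        using on_qubit_mult[of "w ^ 2 \<cdot>\<^sub>m (mat_X * mat_Z)" "mat_S w"] g mult rel by simp
    qed
  next
    fix i j assume ij: "i \<in> {1..n}" "j \<in> {1..n}"
    show "on_qubit n i mat_X * on_qubit n j mat_X = on_qubit n j mat_X * on_qubit n i mat_X"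
      "on_qubit n i mat_Z * on_qubit n j mat_Z = on_qubit n j mat_Z * on_qubit n i mat_Z"
      using on_qubit_commute[OF g(1,1) ij] on_qubit_commute[OF g(2,2) ij] by metis+
    show "on_qubit n j (mat_S w) * on_qubit n i mat_Z = on_qubit n i mat_Z * on_qubit n j (mat_S w)"
      using on_qubit_commute[OF g(4,2) ij(2,1)] mult rel by (cases "i = j") simp_all
    assume "i \<noteq> j"
    then show "on_qubit n i mat_X * on_qubit n j mat_Z = on_qubit n j mat_Z * on_qubit n i mat_X"
      "on_qubit n j mat_H * on_qubit n i mat_X = on_qubit n i mat_X * on_qubit n j mat_H"
      "on_qubit n j mat_H * on_qubit n i mat_Z = on_qubit n i mat_Z * on_qubit n j mat_H"
      "on_qubit n j (mat_S w) * on_qubit n i mat_X = on_qubit n i mat_X * on_qubit n j (mat_S w)"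
      using on_qubit_commute ij g by metis+
  next
    fix j assume j: "j \<in> {1..<n}"
    show "CZ_gate n j \<in> carrier ?G" by (rule CZ_gate_unitary[OF j])
    show "CZ_gate n j * on_qubit n j mat_X
        = on_qubit n j mat_X * on_qubit n (Suc j) mat_Z * CZ_gate n j"
      "CZ_gate n j * on_qubit n (Suc j) mat_X
        = on_qubit n j mat_Z * on_qubit n (Suc j) mat_X * CZ_gate n j"
      by (rule CZ_gate_relations[OF j])+
    fix i assume i: "i \<in> {1..n}"
    show "CZ_gate n j * on_qubit n i mat_Z = on_qubit n i mat_Z * CZ_gate n j"
      using CZ_gate_commute[OF g(2) i j] CZ_gate_relations(3,4)[OF j] by metis
    assume "i \<noteq> j" "i \<noteq> Suc j"
    then show "CZ_gate n j * on_qubit n i mat_X = on_qubit n i mat_X * CZ_gate n j"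
      using CZ_gate_commute[OF g(1) i j] by blast
  qed
qed

theorem theorem5p3:
  fixes w :: complex and n :: nat
  assumes "primitive_8th_root w" and "1 \<le> n"
  shows "(centralizer (proj_clifford w n) (cliff_s w n 1 [^]\<^bsub>proj_clifford w n\<^esub> (2::nat)) =
      (if n = 1
       then generate (proj_clifford w n) {cliff_hshsh w n, cliff_s w n 1}
       else generate (proj_clifford w n)
              ({cliff_hshsh w n} \<union> cliff_h w n ` {2..n} \<union> cliff_s w n ` {1..n}
               \<union> cliff_cz w n ` {1..n - 1})))
    \<and> (2 \<le> n \<longrightarrow>
      centralizer (proj_clifford w n) (cliff_s w n 1 [^]\<^bsub>proj_clifford w n\<^esub> (2::nat)) =
      generate (proj_clifford w n)
        ({cliff_hshsh w n} \<union> cliff_h w n ` {2..n} \<union> cliff_s w n ` {2..n}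
         \<union> cliff_cz w n ` {1..n - 1}))"
proof -
  interpret Q: projective_clifford_gates "unitary_group (2 ^ n)" n "global_phases n"
    "(-1) \<cdot>\<^sub>m 1\<^sub>m (2 ^ n)" "w ^ 2 \<cdot>\<^sub>m 1\<^sub>m (2 ^ n)"
    "\<lambda>i. on_qubit n i mat_X" "\<lambda>i. on_qubit n i mat_Z" "\<lambda>i. on_qubit n i mat_H"
    "\<lambda>i. on_qubit n i (mat_S w)" "CZ_gate n"
    by (rule qubit_gates[OF assms(1)])
  have norm: "Q.normalizer_group = pauli_normalizer w n"
    unfolding pauli_normalizer_def Q.pauli_def pauli_group_def ..
  have cls: "Q.cls = phase_class w n"
    unfolding Q.cls_def phase_class_def norm by (rule ext) simp
  have Proj: "Q.Proj = proj_clifford w n"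
    unfolding Q.Proj_def proj_clifford_def norm ..
  have gates: "phase_class w n (on_qubit n i mat_H) = cliff_h w n i"
    "phase_class w n (on_qubit n i (mat_S w)) = cliff_s w n i"
    "phase_class w n (CZ_gate n i) = cliff_cz w n i" for i
    unfolding cliff_h_def cliff_s_def cliff_cz_def by simp_all
  have flip: "phase_class w n Q.flip_gate = cliff_hshsh w n"
    using Q.cls_flip_gate[OF assms(2)] unfolding cls Proj gates cliff_hshsh_def by simp
  have I: "{1..<n} = {1..n - 1}" using assms(2) by auto
  have gens: "phase_class w n ` Q.stab_gens
      = {cliff_hshsh w n} \<union> cliff_h w n ` {2..n} \<union> cliff_s w n ` {2..n} \<union> cliff_cz w n ` {1..n - 1}"
    unfolding Q.stab_gens_def I by (simp add: image_Un image_image gates flip)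
  have "{1..n} = insert 1 {2..n}" using assms(2) by auto
  then have S1: "insert (cliff_s w n 1) (cliff_s w n ` {2..n}) = cliff_s w n ` {1..n}" by simp
  have cent: "centralizer (proj_clifford w n) (cliff_s w n 1 [^]\<^bsub>proj_clifford w n\<^esub> (2::nat))
      = generate (proj_clifford w n) ({cliff_hshsh w n} \<union> cliff_h w n ` {2..n}
          \<union> cliff_s w n ` {1..n} \<union> cliff_cz w n ` {1..n - 1})"
    using Q.centralizer_S1_squared(1)[OF assms(2)]
    unfolding cls Proj gates image_insert gens S1[symmetric] by (simp add: insert_commute)
  moreover have "2 \<le> n \<Longrightarrow>
      centralizer (proj_clifford w n) (cliff_s w n 1 [^]\<^bsub>proj_clifford w n\<^esub> (2::nat))
      = generate (proj_clifford w n) ({cliff_hshsh w n} \<union> cliff_h w n ` {2..n}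
          \<union> cliff_s w n ` {2..n} \<union> cliff_cz w n ` {1..n - 1})"
    using Q.centralizer_S1_squared(2)[OF assms(2)] unfolding cls Proj gates gens .
  ultimately show ?thesis by auto
qed

end
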